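(* Let $\mathscr C$ be a category with a final object and fiber products, in which all fiber squares are independent, and let $F^*(-)$ be a contravariant functor on $\mathscr C$ with values in the category of graded abelian groups. For each morphism $f:X\to Y$ let an element $c\in\mathbb B^{coop}F^i(X\xrightarrow{f}Y)$ be a collection of homomorphisms $$c_g:F^m(X')\to F^{m+i}(Y')$$ for all $m\in\mathbb Z$ and all $g:Y'\to Y$, where $X'=X\times_Y Y'$ is the fiber product with projections $g':X'\to X$ and $f':X'\to Y'$. These homomorphisms are required to be compatible with pullback: for all $g:Y'\to Y$ and $h:Y''\to Y'$, with $X''=X'\times_{Y'}Y''$ and projections $h':X''\to X'$, $f'':X''\to Y''$, one has $$c_{g\circ h}\circ (h')^*=h^*\circ c_g: F^m(X')\to F^{m+i}(Y'').$$ Define the following operations. 1. Product $\bullet:\mathbb B^{coop}F^i(X\xrightarrow{f}Y)\otimes\mathbb B^{coop}F^j(Y\xrightarrow{g}Z)\to\mathbb B^{coop}F^{i+j}(X\xrightarrow{g\circ f}Z)$: for $h:Z'\to Z$, with $Y'=Y\times_Z Z'$, $h':Y'\to Y$ the projection and $X'=X\times_Y Y'$, $$(c\bullet d)_h:=d_h\circ c_{h'}:F^m(X')\xrightarrow{c_{h'}}F^{m+i}(Y')\xrightarrow{d_h}F^{m+i+j}(Z').$$ 2. Pushforward, for $X\xrightarrow{f}Y\xrightarrow{g}Z$, $f_*:\mathbb B^{coop}F^i(X\xrightarrow{g\circ f}Z)\to\mathbb B^{coop}F^i(Y\xrightarrow{g}Z)$: for $h:Z'\to Z$, with $Y'=Y\times_Z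 Z'$, $X'=X\times_Y Y'$ and $f':X'\to Y'$ the projection, $$(f_*c)_h:=c_h\circ(f')^*:F^m(Y')\xrightarrow{(f')^*}F^m(X')\xrightarrow{c_h}F^{m+i}(Z').$$ 3. Pullback, for $f:X\to Y$ and $g:Y'\to Y$ with $X'=X\times_YY'$ and $f':X'\to Y'$ the projection, $g^*:\mathbb B^{coop}F^i(X\xrightarrow{f}Y)\to\mathbb B^{coop}F^i(X'\xrightarrow{f'}Y')$: for $h:Y''\to Y'$ and $X''=X'\times_{Y'}Y''$, $$(g^*c)_h:=c_{g\circ h}:F^m(X'')\to F^{m+i}(Y'').$$ Then $\mathbb B^{coop}F^*$ becomes a bivariant theory, i.e., it satisfies the seven axioms $(A_1)$, $(A_2)$, $(A_3)$, $(A_{12})$, $(A_{13})$, $(A_{23})$, $(A_{123})$ of a bivariant theory.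
   Context: A bivariant theory $\mathbb B$ on $\mathscr C$ assigns to each morphism $f:X\to Y$ a graded abelian group $\mathbb B(X\xrightarrow{f}Y)=\bigoplus_i\mathbb B^i(X\xrightarrow{f}Y)$, together with: a product $\bullet:\mathbb B^i(X\xrightarrow{f}Y)\otimes\mathbb B^j(Y\xrightarrow{g}Z)\to\mathbb B^{i+j}(X\xrightarrow{g\circ f}Z)$; a pushforward $f_*:\mathbb B^i(X\xrightarrow{g\circ f}Z)\to\mathbb B^i(Y\xrightarrow{g}Z)$ for "confined" $f$; and a pullback $g^*:\mathbb B^i(X\xrightarrow{f}Y)\to\mathbb B^i(X'\xrightarrow{f'}Y')$ for each "independent" square with bottom map $g:Y'\to Y$, right map $f:X\to Y$, left map $f':X'\to Y'$ and top map $g':X'\to X$. Here the independent squares are all fiber squares, and pushforward is defined for every morphism $f$ (i.e. every morphism is confined). The seven axioms are the following. - $(A_1)$ Product is associative: $(\alpha\bullet\beta)\bullet\gamma=\alpha\bullet(\beta\bullet\gamma)$ for $\alpha\in\mathbb B(X\to Y)$, $\beta\in\mathbb B(Y\to Z)$, $\gamma\in\mathbb B(Z\to W)$. - $(A_2)$ Pushforward is functorial: $(g\circ f)_*\alpha=g_*(f_*\alpha)$ for $X\xrightarrow{f}Y\xrightarrow{g}Z\xrightarrow{h}W$, $f,g$ confined, and $\alpha\in\mathbb B(X\xrightarrow{h\circ g\circ f}W)$. - $(A_3)$ Pullback is functorial: $(g\circ h)^*=h^*\circ g^*$ for $Y''\xrightarrow{h}Y'\xrightarrow{g}Y$. - $(A_{12})$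 Product and pushforward commute: $f_*(\alpha\bullet\beta)=f_*\alpha\bullet\beta$ for $X\xrightarrow{f}Y\xrightarrow{g}Z\xrightarrow{h}W$, $f$ confined, $\alpha\in\mathbb B(X\xrightarrow{g\circ f}Z)$, $\beta\in\mathbb B(Z\xrightarrow{h}W)$. - $(A_{13})$ Product and pullback commute: $h^*(\alpha\bullet\beta)=(h')^*\alpha\bullet h^*\beta$ for $\alpha\in\mathbb B(X\xrightarrow{f}Y)$, $\beta\in\mathbb B(Y\xrightarrow{g}Z)$, $h:Z'\to Z$, $Y'=Y\times_ZZ'$ and projection $h':Y'\to Y$. - $(A_{23})$ Pushforward and pullback commute: $f'_*(h^*\alpha)=h^*(f_*\alpha)$ for $X\xrightarrow{f}Y\xrightarrow{g}Z$, $f$ confined, $\alpha\in\mathbb B(X\xrightarrow{g\circ f}Z)$, $h:Z'\to Z$, where $f':X'\to Y'$ is the base change of $f$ along $Y'=Y\times_ZZ'\to Y$. - $(A_{123})$ Projection formula: $g'_*(g^*\alpha\bullet\beta)=\alpha\bullet g_*\beta$ for $\alpha\in\mathbb B(X\xrightarrow{f}Y)$, $g:Y'\to Y$ confined, $h:Y\to Z$, $\beta\in\mathbb B(Y'\xrightarrow{h\circ g}Z)$, and $g':X'=X\times_YY'\to X$ the projection. *)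

theory Defs
  imports "HOL-Algebra.Group"
begin

section \<open>Categories with a final object and fiber products\<close>

record ('o, 'm) category =
  obj :: "'o set"
  arr :: "'m set"
  src :: "'m \<Rightarrow> 'o"
  tgt :: "'m \<Rightarrow> 'o"
  ident :: "'o \<Rightarrow> 'm"
  comp :: "'m \<Rightarrow> 'm \<Rightarrow> 'm"  (infixr \<open>\<cdot>\<index>\<close> 75)

text \<open>The composite \<open>g \<circ> f\<close> is written \<open>g \<cdot> f\<close>; it is meaningful only if \<open>tgt f = src g\<close>.\<close>

locale category =
  fixes C :: "('o, 'm) category" (structure)
  assumes src_obj: "f \<in> arr C \<Longrightarrow> src C f \<in> obj C"
    and tgt_obj: "f \<in> arr C \<Longrightarrow> tgt C f \<in> obj C"
    and ident_arr: "X \<in> obj C \<Longrightarrow> ident C X \<in> arr C"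
    and src_ident: "X \<in> obj C \<Longrightarrow> src C (ident C X) = X"
    and tgt_ident: "X \<in> obj C \<Longrightarrow> tgt C (ident C X) = X"
    and comp_arr: "\<lbrakk>f \<in> arr C; g \<in> arr C; tgt C f = src C g\<rbrakk> \<Longrightarrow> g \<cdot> f \<in> arr C"
    and src_comp: "\<lbrakk>f \<in> arr C; g \<in> arr C; tgt C f = src C g\<rbrakk> \<Longrightarrow> src C (g \<cdot> f) = src C f"
    and tgt_comp: "\<lbrakk>f \<in> arr C; g \<in> arr C; tgt C f = src C g\<rbrakk> \<Longrightarrow> tgt C (g \<cdot> f) = tgt C g"
    and comp_ident: "f \<in> arr C \<Longrightarrow> f \<cdot> ident C (src C f) = f"
    and ident_comp: "f \<in> arr C \<Longrightarrow> ident C (tgt C f) \<cdot> f = f"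
    and comp_assoc: "\<lbrakk>f \<in> arr C; g \<in> arr C; h \<in> arr C; tgt C f = src C g; tgt C g = src C h\<rbrakk>
        \<Longrightarrow> (h \<cdot> g) \<cdot> f = h \<cdot> (g \<cdot> f)"

definition final_object :: "('o, 'm) category \<Rightarrow> 'o \<Rightarrow> bool" where
  "final_object C T \<longleftrightarrow>
     T \<in> obj C \<and> (\<forall>X\<in>obj C. \<exists>!t. t \<in> arr C \<and> src C t = X \<and> tgt C t = T)"

text \<open>
  \<open>fiber_square C g' f' f g\<close>: the square with top \<open>g' : X' \<rightarrow> X\<close>, left \<open>f' : X' \<rightarrow> Y'\<close>,
  right \<open>f : X \<rightarrow> Y\<close> and bottom \<open>g : Y' \<rightarrow> Y\<close> is a fiber square.
\<close>

definition is_mediating :: "('o, 'm) category \<Rightarrow> 'm \<Rightarrow> 'm \<Rightarrow> 'm \<Rightarrow> 'm \<Rightarrow> 'm \<Rightarrow> bool" where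
  "is_mediating C g' f' a b u \<longleftrightarrow>
     u \<in> arr C \<and> src C u = src C a \<and> tgt C u = src C g' \<and>
     g' \<cdot>\<^bsub>C\<^esub> u = a \<and> f' \<cdot>\<^bsub>C\<^esub> u = b"

definition fiber_square :: "('o, 'm) category \<Rightarrow> 'm \<Rightarrow> 'm \<Rightarrow> 'm \<Rightarrow> 'm \<Rightarrow> bool" where
  "fiber_square C g' f' f g \<longleftrightarrow>
     g' \<in> arr C \<and> f' \<in> arr C \<and> f \<in> arr C \<and> g \<in> arr C \<and>
     src C g' = src C f' \<and> tgt C g' = src C f \<and> tgt C f' = src C g \<and> tgt C f = tgt C g \<and>
     f \<cdot>\<^bsub>C\<^esub> g' = g \<cdot>\<^bsub>C\<^esub> f' \<and>
     (\<forall>a b. a \<in> arr C \<and> b \<in> arr C \<and> src C a = src C b \<and> tgt C a = src C f \<and> tgt C b = src C g \<and>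
        f \<cdot>\<^bsub>C\<^esub> a = g \<cdot>\<^bsub>C\<^esub> b \<longrightarrow> (\<exists>!u. is_mediating C g' f' a b u))"

locale fiber_category = category +
  assumes has_final_object: "\<exists>T. final_object C T"
    and has_fiber_products:
      "\<lbrakk>f \<in> arr C; g \<in> arr C; tgt C f = tgt C g\<rbrakk> \<Longrightarrow> \<exists>g' f'. fiber_square C g' f' f g"

text \<open>
  For \<open>f : X \<rightarrow> Y\<close> and \<open>g : Y' \<rightarrow> Y\<close> the notation \<open>X \<times>\<^sub>Y Y'\<close> refers to a fiber product
  chosen once and for all, with projections \<open>pr1 C f g : X \<times>\<^sub>Y Y' \<rightarrow> X\<close> and
  \<open>pr2 C f g : X \<times>\<^sub>Y Y' \<rightarrow> Y'\<close>.
\<close>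

definition fiber_projections :: "('o, 'm) category \<Rightarrow> 'm \<Rightarrow> 'm \<Rightarrow> 'm \<times> 'm" where
  "fiber_projections C f g = (SOME (g', f'). fiber_square C g' f' f g)"

definition pr1 :: "('o, 'm) category \<Rightarrow> 'm \<Rightarrow> 'm \<Rightarrow> 'm" where
  "pr1 C f g = fst (fiber_projections C f g)"

definition pr2 :: "('o, 'm) category \<Rightarrow> 'm \<Rightarrow> 'm \<Rightarrow> 'm" where
  "pr2 C f g = snd (fiber_projections C f g)"

definition fiber_prod :: "('o, 'm) category \<Rightarrow> 'm \<Rightarrow> 'm \<Rightarrow> 'o" where
  "fiber_prod C f g = src C (pr2 C f g)"

definition mediating :: "('o, 'm) category \<Rightarrow> 'm \<Rightarrow> 'm \<Rightarrow> 'm \<Rightarrow> 'm \<Rightarrow> 'm" where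
  "mediating C g' f' a b = (THE u. is_mediating C g' f' a b u)"

section \<open>Bivariant theories\<close>

text \<open>
  Every morphism is confined and every fiber square is independent. A graded abelian group is
  given by its homogeneous parts, so \<open>B f i\<close> is the group \<open>B\<^sup>i(X \<rightarrow> Y)\<close> of \<open>f : X \<rightarrow> Y\<close>.
  Abelian groups are written multiplicatively. A homomorphism out of a tensor product is given
  as a map that is a homomorphism in each argument.

  \<^item> \<open>prod f g i j : B\<^sup>i(f) \<times> B\<^sup>j(g) \<rightarrow> B\<^sup>i\<^sup>+\<^sup>j(g \<cdot> f)\<close>;
  \<^item> \<open>push f g i : B\<^sup>i(g \<cdot> f) \<rightarrow> B\<^sup>i(g)\<close> is the pushforward along \<open>f\<close>;
  \<^item> \<open>pull g' f' f g i : B\<^sup>i(f) \<rightarrow> B\<^sup>i(f')\<close> is the pullback along \<open>g\<close> for the fiber square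
    with top \<open>g'\<close>, left \<open>f'\<close>, right \<open>f\<close>, bottom \<open>g\<close>.
\<close>

locale bivariant_theory = fiber_category C
  for C :: "('o, 'm) category" (structure) +
  fixes B :: "'m \<Rightarrow> int \<Rightarrow> 'b monoid"
    and prod :: "'m \<Rightarrow> 'm \<Rightarrow> int \<Rightarrow> int \<Rightarrow> 'b \<Rightarrow> 'b \<Rightarrow> 'b"
    and push :: "'m \<Rightarrow> 'm \<Rightarrow> int \<Rightarrow> 'b \<Rightarrow> 'b"
    and pull :: "'m \<Rightarrow> 'm \<Rightarrow> 'm \<Rightarrow> 'm \<Rightarrow> int \<Rightarrow> 'b \<Rightarrow> 'b"
  assumes group_B: "f \<in> arr C \<Longrightarrow> comm_group (B f i)"
    and prod_hom_right:
      "\<lbrakk>f \<in> arr C; g \<in> arr C; tgt C f = src C g; \<alpha> \<in> carrier (B f i)\<rbrakk>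
        \<Longrightarrow> (\<lambda>\<beta>. prod f g i j \<alpha> \<beta>) \<in> hom (B g j) (B (g \<cdot> f) (i + j))"
    and prod_hom_left:
      "\<lbrakk>f \<in> arr C; g \<in> arr C; tgt C f = src C g; \<beta> \<in> carrier (B g j)\<rbrakk>
        \<Longrightarrow> (\<lambda>\<alpha>. prod f g i j \<alpha> \<beta>) \<in> hom (B f i) (B (g \<cdot> f) (i + j))"
    and push_hom:
      "\<lbrakk>f \<in> arr C; g \<in> arr C; tgt C f = src C g\<rbrakk>
        \<Longrightarrow> push f g i \<in> hom (B (g \<cdot> f) i) (B g i)"
    and pull_hom:
      "fiber_square C g' f' f g \<Longrightarrow> pull g' f' f g i \<in> hom (B f i) (B f' i)"
    and A1:
      "\<lbrakk>f \<in> arr C; g \<in> arr C; h \<in> arr C; tgt C f = src C g; tgt C g = src C h;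
        \<alpha> \<in> carrier (B f i); \<beta> \<in> carrier (B g j); \<gamma> \<in> carrier (B h k)\<rbrakk>
        \<Longrightarrow> prod (g \<cdot> f) h (i + j) k (prod f g i j \<alpha> \<beta>) \<gamma> =
            prod f (h \<cdot> g) i (j + k) \<alpha> (prod g h j k \<beta> \<gamma>)"
    and A2:
      "\<lbrakk>f \<in> arr C; g \<in> arr C; h \<in> arr C; tgt C f = src C g; tgt C g = src C h;
        \<alpha> \<in> carrier (B (h \<cdot> g \<cdot> f) i)\<rbrakk>
        \<Longrightarrow> push (g \<cdot> f) h i \<alpha> = push g h i (push f (h \<cdot> g) i \<alpha>)"
    and A3:
      "\<lbrakk>fiber_square C g' f' f g; fiber_square C h' f'' f' h; \<alpha> \<in> carrier (B f i)\<rbrakk>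
        \<Longrightarrow> pull (g' \<cdot> h') f'' f (g \<cdot> h) i \<alpha> = pull h' f'' f' h i (pull g' f' f g i \<alpha>)"
    and A12:
      "\<lbrakk>f \<in> arr C; g \<in> arr C; h \<in> arr C; tgt C f = src C g; tgt C g = src C h;
        \<alpha> \<in> carrier (B (g \<cdot> f) i); \<beta> \<in> carrier (B h j)\<rbrakk>
        \<Longrightarrow> push f (h \<cdot> g) (i + j) (prod (g \<cdot> f) h i j \<alpha> \<beta>) = prod g h i j (push f g i \<alpha>) \<beta>"
    and A13:
      "\<lbrakk>fiber_square C h' g' g h; fiber_square C h'' f' f h';
        \<alpha> \<in> carrier (B f i); \<beta> \<in> carrier (B g j)\<rbrakk>
        \<Longrightarrow> pull h'' (g' \<cdot> f') (g \<cdot> f) h (i + j) (prod f g i j \<alpha> \<beta>) =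
            prod f' g' i j (pull h'' f' f h' i \<alpha>) (pull h' g' g h j \<beta>)"
    and A23:
      "\<lbrakk>fiber_square C h' g' g h; fiber_square C h'' f' f h'; \<alpha> \<in> carrier (B (g \<cdot> f) i)\<rbrakk>
        \<Longrightarrow> push f' g' i (pull h'' (g' \<cdot> f') (g \<cdot> f) h i \<alpha>) = pull h' g' g h i (push f g i \<alpha>)"
    and A123:
      "\<lbrakk>fiber_square C g' f' f g; h \<in> arr C; tgt C g = src C h;
        \<alpha> \<in> carrier (B f i); \<beta> \<in> carrier (B (h \<cdot> g) j)\<rbrakk>
        \<Longrightarrow> push g' (h \<cdot> f) (i + j) (prod f' (h \<cdot> g) i j (pull g' f' f g i \<alpha>) \<beta>) =
            prod f h i j \<alpha> (push g h j \<beta>)"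

section \<open>Contravariant functors to graded abelian groups\<close>

text \<open>\<open>gr F X m\<close> is \<open>F\<^sup>m(X)\<close>, and \<open>fmap F f m : F\<^sup>m(Y) \<rightarrow> F\<^sup>m(X)\<close> is \<open>f\<^sup>*\<close> for \<open>f : X \<rightarrow> Y\<close>.\<close>

record ('o, 'm, 'a) graded_functor =
  gr :: "'o \<Rightarrow> int \<Rightarrow> 'a monoid"
  fmap :: "'m \<Rightarrow> int \<Rightarrow> 'a \<Rightarrow> 'a"

locale contravariant_graded_functor = category C
  for C :: "('o, 'm) category" (structure) +
  fixes F :: "('o, 'm, 'a) graded_functor"
  assumes group_gr: "X \<in> obj C \<Longrightarrow> comm_group (gr F X m)"
    and fmap_hom: "f \<in> arr C \<Longrightarrow> fmap F f m \<in> hom (gr F (tgt C f) m) (gr F (src C f) m)"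
    and fmap_ident: "\<lbrakk>X \<in> obj C; x \<in> carrier (gr F X m)\<rbrakk> \<Longrightarrow> fmap F (ident C X) m x = x"
    and fmap_comp: "\<lbrakk>f \<in> arr C; g \<in> arr C; tgt C f = src C g; x \<in> carrier (gr F (tgt C g) m)\<rbrakk>
        \<Longrightarrow> fmap F (g \<cdot> f) m x = fmap F f m (fmap F g m x)"

section \<open>The co-operational bivariant theory\<close>

text \<open>
  An element \<open>c\<close> for \<open>f : X \<rightarrow> Y\<close> is a family \<open>c g m : F\<^sup>m(X \<times>\<^sub>Y Y') \<rightarrow> F\<^sup>m\<^sup>+\<^sup>i(Y')\<close>. All functions
  are extensional, so that equality of elements is equality in HOL.

  The usual formulas also use \<open>c\<^sub>g\<close> on \<open>F\<^sup>m(X')\<close> for fiber products \<open>X'\<close> of \<open>f\<close> and \<open>g\<close> other than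
  the chosen one, such as \<open>X' \<times>\<^bsub>Y'\<^esub> Y''\<close> in place of \<open>X \<times>\<^sub>Y Y''\<close>. The operation \<open>coop_at\<close> is this
  \<open>c\<^sub>g\<close>, obtained by identifying \<open>F\<^sup>m(X')\<close> with \<open>F\<^sup>m(X \<times>\<^sub>Y Y')\<close> through the canonical isomorphism
  \<open>X \<times>\<^sub>Y Y' \<rightarrow> X'\<close>; here \<open>g'\<close>, \<open>f'\<close> are the projections of \<open>X'\<close>.
\<close>

type_synonym ('m, 'a) coop = "'m \<Rightarrow> int \<Rightarrow> 'a \<Rightarrow> 'a"

definition coop_at ::
  "('o, 'm) category \<Rightarrow> ('o, 'm, 'a) graded_functor \<Rightarrow> ('m, 'a) coop \<Rightarrow>
   'm \<Rightarrow> 'm \<Rightarrow> 'm \<Rightarrow> 'm \<Rightarrow> int \<Rightarrow> 'a \<Rightarrow> 'a" where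
  "coop_at C F c g' f' f g m x =
     c g m (fmap F (mediating C g' f' (pr1 C f g) (pr2 C f g)) m x)"

definition arr_to :: "('o, 'm) category \<Rightarrow> 'o \<Rightarrow> 'm set" where
  "arr_to C Y = {g \<in> arr C. tgt C g = Y}"

definition coop_compatible ::
  "('o, 'm) category \<Rightarrow> ('o, 'm, 'a) graded_functor \<Rightarrow> 'm \<Rightarrow> int \<Rightarrow> ('m, 'a) coop \<Rightarrow> bool" where
  "coop_compatible C F f i c \<longleftrightarrow>
     (\<forall>g \<in> arr_to C (tgt C f). \<forall>h \<in> arr_to C (src C g). \<forall>m.
        let g' = pr1 C f g; f' = pr2 C f g; h' = pr1 C f' h; f'' = pr2 C f' h in
        \<forall>x \<in> carrier (gr F (fiber_prod C f g) m).
          coop_at C F c (g' \<cdot>\<^bsub>C\<^esub> h') f'' f (g \<cdot>\<^bsub>C\<^esub> h) m (fmap F h' m x) =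
          fmap F h (m + i) (c g m x))"

definition coop_carrier ::
  "('o, 'm) category \<Rightarrow> ('o, 'm, 'a) graded_functor \<Rightarrow> 'm \<Rightarrow> int \<Rightarrow> ('m, 'a) coop set" where
  "coop_carrier C F f i =
     {c \<in> extensional (arr_to C (tgt C f)).
        (\<forall>g \<in> arr_to C (tgt C f). \<forall>m.
           c g m \<in> hom (gr F (fiber_prod C f g) m) (gr F (src C g) (m + i)) \<and>
           c g m \<in> extensional (carrier (gr F (fiber_prod C f g) m))) \<and>
        coop_compatible C F f i c}"

definition coop_family ::
  "('o, 'm) category \<Rightarrow> ('o, 'm, 'a) graded_functor \<Rightarrow> 'm \<Rightarrow> ('m, 'a) coop \<Rightarrow> ('m, 'a) coop" where
  "coop_family C F f c =
     (\<lambda>g \<in> arr_to C (tgt C f). \<lambda>m. \<lambda>x \<in> carrier (gr F (fiber_prod C f g) m). c g m x)"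

definition coop_group ::
  "('o, 'm) category \<Rightarrow> ('o, 'm, 'a) graded_functor \<Rightarrow> 'm \<Rightarrow> int \<Rightarrow> ('m, 'a) coop monoid" where
  "coop_group C F f i =
     \<lparr>carrier = coop_carrier C F f i,
      mult = (\<lambda>c d. coop_family C F f (\<lambda>g m x. c g m x \<otimes>\<^bsub>gr F (src C g) (m + i)\<^esub> d g m x)),
      one = coop_family C F f (\<lambda>g m x. \<one>\<^bsub>gr F (src C g) (m + i)\<^esub>)\<rparr>"

text \<open>
  The composite \<open>d\<^sub>h \<circ> c\<^bsub>h'\<^esub>\<close> starts at \<open>F\<^sup>m(X \<times>\<^sub>Y Y')\<close> with \<open>Y' = Y \<times>\<^sub>Z Z'\<close>, whereas the member of
  a family for \<open>g \<cdot> f\<close> starts at \<open>F\<^sup>m(X \<times>\<^sub>Z Z')\<close>; \<open>w : X \<times>\<^sub>Y Y' \<rightarrow> X \<times>\<^sub>Z Z'\<close> is the canonical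
  isomorphism.
\<close>

definition coop_prod ::
  "('o, 'm) category \<Rightarrow> ('o, 'm, 'a) graded_functor \<Rightarrow> 'm \<Rightarrow> 'm \<Rightarrow> int \<Rightarrow> int \<Rightarrow>
   ('m, 'a) coop \<Rightarrow> ('m, 'a) coop \<Rightarrow> ('m, 'a) coop" where
  "coop_prod C F f g i j c d =
     coop_family C F (g \<cdot>\<^bsub>C\<^esub> f) (\<lambda>h m x.
       let h' = pr1 C g h; g' = pr2 C g h;
           w = mediating C (pr1 C (g \<cdot>\<^bsub>C\<^esub> f) h) (pr2 C (g \<cdot>\<^bsub>C\<^esub> f) h)
                 (pr1 C f h') (g' \<cdot>\<^bsub>C\<^esub> pr2 C f h')
       in d h (m + i) (c h' m (fmap F w m x)))"

definition coop_push ::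
  "('o, 'm) category \<Rightarrow> ('o, 'm, 'a) graded_functor \<Rightarrow> 'm \<Rightarrow> 'm \<Rightarrow> int \<Rightarrow>
   ('m, 'a) coop \<Rightarrow> ('m, 'a) coop" where
  "coop_push C F f g i c =
     coop_family C F g (\<lambda>h m x.
       let h' = pr1 C g h; g' = pr2 C g h; h'' = pr1 C f h'; f' = pr2 C f h'
       in coop_at C F c h'' (g' \<cdot>\<^bsub>C\<^esub> f') (g \<cdot>\<^bsub>C\<^esub> f) h m (fmap F f' m x))"

definition coop_pull ::
  "('o, 'm) category \<Rightarrow> ('o, 'm, 'a) graded_functor \<Rightarrow> 'm \<Rightarrow> 'm \<Rightarrow> 'm \<Rightarrow> 'm \<Rightarrow> int \<Rightarrow>
   ('m, 'a) coop \<Rightarrow> ('m, 'a) coop" where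
  "coop_pull C F g' f' f g i c =
     coop_family C F f' (\<lambda>h m x.
       let h' = pr1 C f' h; f'' = pr2 C f' h
       in coop_at C F c (g' \<cdot>\<^bsub>C\<^esub> h') f'' f (g \<cdot>\<^bsub>C\<^esub> h) m x)"

end

theory Submission imports Defs begin

text \<open>
  The value \<open>c\<^sub>g\<close> of a co-operation transports along the canonical isomorphisms between fiber products
  (\<open>coop_at_cong\<close>), so all formulas can be written for arbitrary fiber squares. In this form the
  product, pushforward and pullback are given by \<open>d\<^sub>h \<circ> c\<^bsub>h'\<^esub>\<close>, \<open>c\<^sub>h \<circ> (f')\<^sup>*\<close> and \<open>c\<^bsub>g \<circ> h\<^esub>\<close> on any pasting of
  squares, an element is determined by its value on one square over each \<open>g\<close>, and each axiom reduces
  to the associativity of composition on a suitable stack of squares. The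
  projection formula needs in addition that a co-operation is compatible with pullback.
\<close>

section \<open>Fiber squares\<close>

text \<open>Fiber products are picked by choice, so a product formed in two steps and one formed
  along a composite agree only up to canonical isomorphism, whereas the axioms are equations between
  HOL functions. With the square left as a parameter, both sides of an axiom can be read on one
  common stack of squares, where the choices no longer appear. Compatibility with pullback is needed
  already below the axioms: changing the stack that computes a product changes the arrow over which
  the first factor is evaluated, and not only the model of its source (see
  \<open>coop_at_prod\<close>). Pushforward and pullback evaluate over an arrow that does not depend
  on the stack, so canonical transport is enough there.\<close>

context category
begin

text \<open>The equations are turned so that, as rewrite rules, they bring the sources and targets
  of a square to the normal forms \<open>src C g'\<close>, \<open>src C f\<close>,
  \<open>src C g\<close>, \<open>tgt C f\<close> of its four corners.\<close>

lemma fiber_squareD: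
  assumes "fiber_square C g' f' f g"
  shows "g' \<in> arr C" "f' \<in> arr C" "f \<in> arr C" "g \<in> arr C"
    "src C f' = src C g'" "tgt C g' = src C f" "tgt C f' = src C g" "tgt C g = tgt C f"
    "f \<cdot> g' = g \<cdot> f'"
  using assms unfolding fiber_square_def by auto

lemma fiber_square_comp:
  assumes "fiber_square C g' f' f g" "u \<in> arr C" "tgt C u = src C g'"
  shows "f \<cdot> (g' \<cdot> u) = g \<cdot> (f' \<cdot> u)"
  using fiber_squareD[OF assms(1)] assms(2,3) comp_assoc[of u g' f] comp_assoc[of u f' g] by simp

text \<open>Rewriting with \<open>comp_assoc\<close> nests composites to the right, where a known
  factorization \<open>g \<cdot> f\<close> is no longer a subterm; this rule applies it
  there.\<close>

lemma comp_comp_eq: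
  assumes "g \<cdot> f = h" "u \<in> arr C" "f \<in> arr C" "g \<in> arr C" "tgt C u = src C f" "tgt C f = src C g"
  shows "g \<cdot> (f \<cdot> u) = h \<cdot> u"
  using assms comp_assoc[of u f g] by simp

lemma fiber_square_is_mediating:
  assumes "fiber_square C g' f' f g" "a \<in> arr C" "b \<in> arr C" "src C b = src C a"
    "tgt C a = src C f" "tgt C b = src C g" "f \<cdot> a = g \<cdot> b"
  shows "\<exists>!u. is_mediating C g' f' a b u"
  using assms unfolding fiber_square_def by simp

lemma fiber_square_mediating:
  assumes "fiber_square C g' f' f g" "a \<in> arr C" "b \<in> arr C" "src C b = src C a"
    "tgt C a = src C f" "tgt C b = src C g" "f \<cdot> a = g \<cdot> b"
  shows "mediating C g' f' a b \<in> arr C" "src C (mediating C g' f' a b) = src C a"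
    "tgt C (mediating C g' f' a b) = src C g'"
    "g' \<cdot> mediating C g' f' a b = a" "f' \<cdot> mediating C g' f' a b = b"
proof -
  have "is_mediating C g' f' a b (mediating C g' f' a b)"
    unfolding mediating_def by (rule theI'[OF fiber_square_is_mediating[OF assms]])
  then show "mediating C g' f' a b \<in> arr C" "src C (mediating C g' f' a b) = src C a"
    "tgt C (mediating C g' f' a b) = src C g'"
    "g' \<cdot> mediating C g' f' a b = a" "f' \<cdot> mediating C g' f' a b = b"
    unfolding is_mediating_def by auto
qed

lemma fiber_square_unique:
  assumes sq: "fiber_square C g' f' f g" and "u \<in> arr C" "v \<in> arr C" "src C u = src C v"
    "tgt C u = src C g'" "tgt C v = src C g'" "g' \<cdot> u = g' \<cdot> v" "f' \<cdot> u = f' \<cdot> v"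
  shows "u = v"
proof -
  note D = fiber_squareD[OF sq]
  have "f \<cdot> (g' \<cdot> u) = g \<cdot> (f' \<cdot> u)"
    using assms by (intro fiber_square_comp)
  then have "\<exists>!w. is_mediating C g' f' (g' \<cdot> u) (f' \<cdot> u) w"
    using D assms by (intro fiber_square_is_mediating[OF sq]) (auto simp: comp_arr src_comp tgt_comp)
  moreover have "is_mediating C g' f' (g' \<cdot> u) (f' \<cdot> u) u" "is_mediating C g' f' (g' \<cdot> u) (f' \<cdot> u) v"
    unfolding is_mediating_def using D assms by (auto simp: src_comp)
  ultimately show ?thesis by blast
qed

text \<open>The universal property is split in two. Uniqueness is asked in the form that the
  projections are jointly monic, so it can be proved by cancellation without naming a cone.\<close>

lemma fiber_squareI:
  assumes "g' \<in> arr C" "f' \<in> arr C" "f \<in> arr C" "g \<in> arr C"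
    "src C g' = src C f'" "tgt C g' = src C f" "tgt C f' = src C g" "tgt C f = tgt C g"
    "f \<cdot> g' = g \<cdot> f'"
    and ex: "\<And>a b. \<lbrakk>a \<in> arr C; b \<in> arr C; src C b = src C a; tgt C a = src C f;
        tgt C b = src C g; f \<cdot> a = g \<cdot> b\<rbrakk> \<Longrightarrow> \<exists>u. is_mediating C g' f' a b u"
    and un: "\<And>u v. \<lbrakk>u \<in> arr C; v \<in> arr C; src C u = src C v; tgt C u = src C g'; tgt C v = src C g';
        g' \<cdot> u = g' \<cdot> v; f' \<cdot> u = f' \<cdot> v\<rbrakk> \<Longrightarrow> u = v"
  shows "fiber_square C g' f' f g"
  unfolding fiber_square_def
proof (intro conjI allI impI)
  fix a b
  assume h: "a \<in> arr C \<and> b \<in> arr C \<and> src C a = src C b \<and> tgt C a = src C f \<and> tgt C b = src C g \<and>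
        f \<cdot> a = g \<cdot> b"
  then obtain u where u: "is_mediating C g' f' a b u"
    using ex[of a b] by auto
  show "\<exists>!u. is_mediating C g' f' a b u"
  proof (rule ex1I[of _ u])
    fix v assume "is_mediating C g' f' a b v"
    then show "v = u" using u unfolding is_mediating_def by - (rule un; auto)
  qed fact
qed (use assms in auto)

lemma fiber_square_flip:
  assumes "fiber_square C g' f' f g"
  shows "fiber_square C f' g' g f"
proof -
  note D = fiber_squareD[OF assms]
  show ?thesis
  proof (rule fiber_squareI)
    fix a b assume "a \<in> arr C" "b \<in> arr C" "src C b = src C a" "tgt C a = src C g"
      "tgt C b = src C f" "g \<cdot> a = f \<cdot> b"
    with fiber_square_mediating[OF assms, of b a] D show "\<exists>u. is_mediating C f' g' a b u"
      by (intro exI[of _ "mediating C g' f' b a"]) (simp add: is_mediating_def)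
  next
    fix u v assume "u \<in> arr C" "v \<in> arr C" "src C u = src C v" "tgt C u = src C f'"
      "tgt C v = src C f'" "f' \<cdot> u = f' \<cdot> v" "g' \<cdot> u = g' \<cdot> v"
    then show "u = v" using D by - (rule fiber_square_unique[OF assms]; simp_all)
  qed (use D in simp_all)
qed

lemma fiber_square_paste:
  assumes s: "fiber_square C g' f' f g" and t: "fiber_square C h' f'' f' h"
  shows "fiber_square C (g' \<cdot> h') f'' f (g \<cdot> h)"
proof -
  note D = fiber_squareD[OF s] fiber_squareD[OF t]
  show ?thesis
  proof (rule fiber_squareI)
    show "f \<cdot> g' \<cdot> h' = (g \<cdot> h) \<cdot> f''"
      using D fiber_square_comp[OF s, of h'] by (simp add: comp_assoc)
  next
    fix a b assume h: "a \<in> arr C" "b \<in> arr C" "src C b = src C a" "tgt C a = src C f"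
      "tgt C b = src C (g \<cdot> h)" "f \<cdot> a = (g \<cdot> h) \<cdot> b"
    then have hb: "tgt C b = src C h" using D by (simp add: src_comp)
    have "f \<cdot> a = g \<cdot> (h \<cdot> b)" using h hb D by (simp add: comp_assoc)
    note u = fiber_square_mediating[OF s, of a "h \<cdot> b", OF _ _ _ _ _ this]
    \<comment> \<open>A cone over the outer rectangle is lifted in two stages: into \<open>s\<close>
      with second leg \<open>h \<cdot> b\<close>, then from there into \<open>t\<close>.\<close>
    define u where "u = mediating C g' f' a (h \<cdot> b)"
    have u: "u \<in> arr C" "src C u = src C a" "tgt C u = src C g'" "g' \<cdot> u = a" "f' \<cdot> u = h \<cdot> b"
      unfolding u_def using u h hb D by (auto simp: comp_arr src_comp tgt_comp)
    define v where "v = mediating C h' f'' u b"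
    have v: "v \<in> arr C" "src C v = src C u" "tgt C v = src C h'" "h' \<cdot> v = u" "f'' \<cdot> v = b"
      unfolding v_def using fiber_square_mediating[OF t, of u b] u h hb D by auto
    show "\<exists>u. is_mediating C (g' \<cdot> h') f'' a b u"
      using u v D by (intro exI[of _ v]) (auto simp: is_mediating_def src_comp comp_assoc)
  next
    fix u v assume h: "u \<in> arr C" "v \<in> arr C" "src C u = src C v" "tgt C u = src C (g' \<cdot> h')"
       "tgt C v = src C (g' \<cdot> h')" "(g' \<cdot> h') \<cdot> u = (g' \<cdot> h') \<cdot> v" "f'' \<cdot> u = f'' \<cdot> v"
    then have h': "tgt C u = src C h'" "tgt C v = src C h'" using D by (auto simp: src_comp)
    have "g' \<cdot> (h' \<cdot> u) = g' \<cdot> (h' \<cdot> v)" using h h' D by (simp add: comp_assoc)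
    moreover have "f' \<cdot> (h' \<cdot> u) = f' \<cdot> (h' \<cdot> v)"
      using fiber_square_comp[OF t, of u] fiber_square_comp[OF t, of v] h h' by simp
    ultimately have "h' \<cdot> u = h' \<cdot> v"
      using h h' D by - (rule fiber_square_unique[OF s]; auto simp: comp_arr src_comp tgt_comp)
    then show "u = v" using h h' D by - (rule fiber_square_unique[OF t]; auto)
  qed (use D in \<open>auto simp: comp_arr src_comp tgt_comp\<close>)
qed

text \<open>The converse half of the pasting lemma. It supplies squares some of whose edges are
  built from mediating arrows: the comparison square in \<open>coop_at_prod\<close> and two faces of
  the cube in \<open>coop_A123\<close>.\<close>

lemma fiber_square_cancel:
  assumes s: "fiber_square C g' f' f g" and t: "fiber_square C (g' \<cdot> h') f'' f (g \<cdot> h)"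
    and h: "h' \<in> arr C" "tgt C h' = src C g'" "h \<in> arr C" "tgt C h = src C g"
    and c: "f' \<cdot> h' = h \<cdot> f''"
  shows "fiber_square C h' f'' f' h"
proof -
  note D = fiber_squareD[OF s] fiber_squareD[OF t] h
  have D': "src C f'' = src C h'" "tgt C f'' = src C h"
    using D by (auto simp: src_comp)
  show ?thesis
  proof (rule fiber_squareI)
    fix a b assume a: "a \<in> arr C" "b \<in> arr C" "src C b = src C a" "tgt C a = src C f'"
      "tgt C b = src C h" "f' \<cdot> a = h \<cdot> b"
    have eq: "f \<cdot> (g' \<cdot> a) = (g \<cdot> h) \<cdot> b"
      using fiber_square_comp[OF s, of a] a D D' by (simp add: comp_assoc)
    define u where "u = mediating C (g' \<cdot> h') f'' (g' \<cdot> a) b"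
    have u: "u \<in> arr C" "src C u = src C a" "tgt C u = src C h'" "(g' \<cdot> h') \<cdot> u = g' \<cdot> a" "f'' \<cdot> u = b"
      unfolding u_def using fiber_square_mediating[OF t, of "g' \<cdot> a" b] a D D' eq
      by (auto simp: comp_arr src_comp tgt_comp)
    \<comment> \<open>The rectangle controls only \<open>g' \<cdot> (h' \<cdot> u)\<close>; the
      projection to \<open>src C g\<close> is recovered from the commutativity
      \<open>c\<close>.\<close>
    have "h' \<cdot> u = a"
    proof (rule fiber_square_unique[OF s])
      show "g' \<cdot> (h' \<cdot> u) = g' \<cdot> a" using u D by (simp add: comp_assoc)
      show "f' \<cdot> (h' \<cdot> u) = f' \<cdot> a"
        using u a D D' by (simp add: comp_comp_eq[OF c] comp_assoc)
    qed (use a u D D' in \<open>auto simp: comp_arr src_comp tgt_comp\<close>)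
    then show "\<exists>u. is_mediating C h' f'' a b u"
      using u a by (intro exI[of _ u]) (auto simp: is_mediating_def)
  next
    fix u v assume a: "u \<in> arr C" "v \<in> arr C" "src C u = src C v" "tgt C u = src C h'"
       "tgt C v = src C h'" "h' \<cdot> u = h' \<cdot> v" "f'' \<cdot> u = f'' \<cdot> v"
    show "u = v"
      using a D D' by - (rule fiber_square_unique[OF t]; auto simp: src_comp comp_assoc)
  qed (use D D' c in \<open>auto simp: comp_arr src_comp tgt_comp\<close>)
qed

lemma fiber_square_paste_vertical:
  assumes "fiber_square C h' g' g h" and "fiber_square C h'' f' f h'"
  shows "fiber_square C h'' (g' \<cdot> f') (g \<cdot> f) h"
  using assms by (blast intro: fiber_square_flip fiber_square_paste)

end

lemma (in fiber_category) fiber_square_pr: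
  assumes "f \<in> arr C" "g \<in> arr C" "tgt C g = tgt C f"
  shows "fiber_square C (pr1 C f g) (pr2 C f g) f g"
proof -
  have "\<exists>p. fiber_square C (fst p) (snd p) f g"
    using has_fiber_products[of f g] assms by auto
  from someI_ex[OF this] show ?thesis
    by (simp add: pr1_def pr2_def fiber_projections_def case_prod_unfold)
qed

section \<open>Co-operations on arbitrary fiber squares\<close>

locale coop_setting = fiber_category C + contravariant_graded_functor C F
  for C :: "('o, 'm) category" (structure) and F :: "('o, 'm, 'a) graded_functor"
begin

abbreviation sq where "sq \<equiv> fiber_square C"
abbreviation el where "el X m \<equiv> carrier (gr F X m)"
abbreviation at where "at \<equiv> coop_at C F"

lemma fmap_closed: "\<lbrakk>f \<in> arr C; x \<in> el (tgt C f) m\<rbrakk> \<Longrightarrow> fmap F f m x \<in> el (src C f) m"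
  using fmap_hom[of f m] by (auto simp: hom_def)

lemma fmap_closed': "\<lbrakk>f \<in> arr C; x \<in> el Y m; tgt C f = Y; src C f = X\<rbrakk> \<Longrightarrow> fmap F f m x \<in> el X m"
  using fmap_closed by auto

lemma arr_toI: "\<lbrakk>g \<in> arr C; tgt C g = Y\<rbrakk> \<Longrightarrow> g \<in> arr_to C Y"
  by (simp add: arr_to_def)

lemma arr_toD: "g \<in> arr_to C Y \<Longrightarrow> g \<in> arr C" "g \<in> arr_to C Y \<Longrightarrow> tgt C g = Y"
  by (auto simp: arr_to_def)

lemma sq_pr: "\<lbrakk>f \<in> arr C; g \<in> arr_to C (tgt C f)\<rbrakk> \<Longrightarrow> sq (pr1 C f g) (pr2 C f g) f g"
  by (auto simp: arr_to_def intro: fiber_square_pr)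

lemma fiber_prod_src: "sq (pr1 C f g) (pr2 C f g) f g \<Longrightarrow> fiber_prod C f g = src C (pr1 C f g)"
  by (simp add: fiber_prod_def fiber_squareD)

text \<open>\<open>at\<close> restricts \<open>x\<close> along the mediating arrow out of the chosen
  product. The one into the first square, followed by \<open>u\<close>, has the same projections as
  the one into the second square and hence equals it; functoriality of \<open>F\<close> does the
  rest.\<close>

lemma coop_at_cong:
  assumes s: "sq a b f g" and t: "sq a' b' f g"
    and u: "u \<in> arr C" "src C u = src C a" "tgt C u = src C a'" "a' \<cdot> u = a" "b' \<cdot> u = b"
    and x: "x \<in> el (src C a') m"
  shows "at c a b f g m (fmap F u m x) = at c a' b' f g m x"
proof -
  note D = fiber_squareD[OF s] fiber_squareD[OF t]
  have p: "sq (pr1 C f g) (pr2 C f g) f g" using D by (intro fiber_square_pr) auto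
  note P = fiber_squareD[OF p]
  note v = fiber_square_mediating[OF s P(1,2,5,6,7,9)]
  note w = fiber_square_mediating[OF t P(1,2,5,6,7,9)]
  let ?v = "mediating C a b (pr1 C f g) (pr2 C f g)"
  let ?w = "mediating C a' b' (pr1 C f g) (pr2 C f g)"
  have "u \<cdot> ?v = ?w"
  proof (rule fiber_square_unique[OF t])
    show "a' \<cdot> (u \<cdot> ?v) = a' \<cdot> ?w" "b' \<cdot> (u \<cdot> ?v) = b' \<cdot> ?w"
      using u v w D by (simp_all add: comp_assoc[symmetric])
  qed (use u v w in \<open>auto simp: comp_arr src_comp tgt_comp\<close>)
  moreover have "fmap F (u \<cdot> ?v) m x = fmap F ?v m (fmap F u m x)"
    using u v x by (intro fmap_comp) auto
  ultimately show ?thesis unfolding coop_at_def by simp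
qed

text \<open>For the chosen square the mediating arrow is an identity.\<close>

lemma coop_at_pr:
  assumes p: "sq (pr1 C f g) (pr2 C f g) f g" and x: "x \<in> el (fiber_prod C f g) m"
  shows "at c (pr1 C f g) (pr2 C f g) f g m x = c g m x"
proof -
  note P = fiber_squareD[OF p]
  note v = fiber_square_mediating[OF p P(1,2,5,6,7,9)]
  have "mediating C (pr1 C f g) (pr2 C f g) (pr1 C f g) (pr2 C f g) = ident C (src C (pr1 C f g))"
  proof (rule fiber_square_unique[OF p])
    show "pr1 C f g \<cdot> mediating C (pr1 C f g) (pr2 C f g) (pr1 C f g) (pr2 C f g) =
        pr1 C f g \<cdot> ident C (src C (pr1 C f g))"
      using v P comp_ident[of "pr1 C f g"] by simp
    show "pr2 C f g \<cdot> mediating C (pr1 C f g) (pr2 C f g) (pr1 C f g) (pr2 C f g) =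
        pr2 C f g \<cdot> ident C (src C (pr1 C f g))"
      using v P comp_ident[of "pr2 C f g"] by simp
  qed (use v P in \<open>auto simp: ident_arr src_ident tgt_ident src_obj\<close>)
  then show ?thesis
    using x P by (simp add: coop_at_def fmap_ident src_obj fiber_prod_src[OF p])
qed

text \<open>The comparison arrows \<open>u\<close> between the squares over \<open>g\<close> and
  \<open>k\<close> between those adjoined along \<open>h\<close> satisfy
  \<open>H' \<cdot> k = u \<cdot> h'\<close>, so transport between models commutes with restriction
  along the projections. As \<open>c\<close> is an arbitrary family, the lemma serves both to
  exploit membership (\<open>coop_at_fmap\<close>) and to prove it
  (\<open>coop_carrierI\<close>).\<close>

lemma coop_at_fmap_transfer:
  assumes s: "sq g' f' f g" and t: "sq h' f'' f' h"
    and S: "sq G' F' f g" and T: "sq H' F'' F' h"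
    and c: "\<And>x. x \<in> el (src C g') m \<Longrightarrow>
      at c (g' \<cdot> h') f'' f (g \<cdot> h) m (fmap F h' m x) = fmap F h n (at c g' f' f g m x)"
    and x: "x \<in> el (src C G') m"
  shows "at c (G' \<cdot> H') F'' f (g \<cdot> h) m (fmap F H' m x) = fmap F h n (at c G' F' f g m x)"
proof -
  note D = fiber_squareD[OF s] fiber_squareD[OF t]
  note E = fiber_squareD[OF S] fiber_squareD[OF T]
  note st = fiber_square_paste[OF s t] and ST = fiber_square_paste[OF S T]
  define u where "u = mediating C G' F' g' f'"
  have u: "u \<in> arr C" "src C u = src C g'" "tgt C u = src C G'" "G' \<cdot> u = g'" "F' \<cdot> u = f'"
    unfolding u_def using fiber_square_mediating[OF S, of g' f'] D E by auto
  have eq: "F' \<cdot> (u \<cdot> h') = h \<cdot> f''"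
    using u D E by (simp add: comp_assoc[symmetric])
  define k where "k = mediating C H' F'' (u \<cdot> h') f''"
  have k: "k \<in> arr C" "src C k = src C h'" "tgt C k = src C H'" "H' \<cdot> k = u \<cdot> h'" "F'' \<cdot> k = f''"
    unfolding k_def using fiber_square_mediating[OF T, of "u \<cdot> h'" f''] eq u D E
    by (auto simp: comp_arr src_comp tgt_comp)
  have ux: "fmap F u m x \<in> el (src C g') m" using u x by (intro fmap_closed') auto
  have k': "(G' \<cdot> H') \<cdot> k = g' \<cdot> h'" using k u D E comp_comp_eq[OF u(4), of h'] by (simp add: comp_assoc)
  have "at c (G' \<cdot> H') F'' f (g \<cdot> h) m (fmap F H' m x) =
      at c (g' \<cdot> h') f'' f (g \<cdot> h) m (fmap F k m (fmap F H' m x))"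
    using k D E x k' by (intro coop_at_cong[OF st ST, symmetric] fmap_closed') (auto simp: src_comp)
  also have "fmap F k m (fmap F H' m x) = fmap F (H' \<cdot> k) m x"
    using k E x by (intro fmap_comp[symmetric]) auto
  also have "\<dots> = fmap F h' m (fmap F u m x)"
    unfolding k using u D E x by (intro fmap_comp) auto
  also have "at c (g' \<cdot> h') f'' f (g \<cdot> h) m \<dots> = fmap F h n (at c g' f' f g m (fmap F u m x))"
    by (rule c[OF ux])
  also have "at c g' f' f g m (fmap F u m x) = at c G' F' f g m x"
    using u x by (intro coop_at_cong[OF s S]) auto
  finally show ?thesis .
qed

text \<open>\<open>coop_compatible\<close> speaks only of the chosen square over \<open>g\<close>
  and the chosen one adjoined to it; \<open>coop_at_fmap_transfer\<close> carries this to all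
  squares.\<close>

lemma coop_at_fmap:
  assumes c: "c \<in> coop_carrier C F f i"
    and s: "sq g' f' f g" and t: "sq h' f'' f' h"
    and x: "x \<in> el (src C g') m"
  shows "at c (g' \<cdot> h') f'' f (g \<cdot> h) m (fmap F h' m x) = fmap F h (m + i) (at c g' f' f g m x)"
proof -
  note D = fiber_squareD[OF s] fiber_squareD[OF t]
  have g: "g \<in> arr_to C (tgt C f)" and h: "h \<in> arr_to C (src C g)"
    using D by (auto simp: arr_to_def)
  note p = sq_pr[OF D(3) g]
  note P = fiber_squareD[OF p]
  have q: "sq (pr1 C (pr2 C f g) h) (pr2 C (pr2 C f g) h) (pr2 C f g) h"
    using h P by (intro sq_pr) auto
  show ?thesis
  proof (rule coop_at_fmap_transfer[OF p q s t _ x])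
    fix x assume "x \<in> el (src C (pr1 C f g)) m"
    then have x: "x \<in> el (fiber_prod C f g) m" using fiber_prod_src[OF p] by simp
    show "at c (pr1 C f g \<cdot> pr1 C (pr2 C f g) h) (pr2 C (pr2 C f g) h) f (g \<cdot> h) m
        (fmap F (pr1 C (pr2 C f g) h) m x) =
      fmap F h (m + i) (at c (pr1 C f g) (pr2 C f g) f g m x)"
      unfolding coop_at_pr[OF p x] using c g h x
      by (auto simp: coop_carrier_def coop_compatible_def Let_def)
  qed
qed

text \<open>The arrow \<open>u\<close> is fixed before \<open>c\<close>, \<open>m\<close> and
  \<open>y\<close>, so one choice serves both families compared in \<open>coop_eqI\<close>.\<close>

lemma coop_at_eq_apply:
  assumes s: "sq g' f' f g"
  obtains u where "u \<in> arr C" "src C u = src C g'" "tgt C u = fiber_prod C f g"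
    "\<And>c m y. y \<in> el (fiber_prod C f g) m \<Longrightarrow> c g m y = at c g' f' f g m (fmap F u m y)"
proof -
  note D = fiber_squareD[OF s]
  have p: "sq (pr1 C f g) (pr2 C f g) f g" using D by (intro fiber_square_pr) auto
  let ?u = "mediating C (pr1 C f g) (pr2 C f g) g' f'"
  note u = fiber_square_mediating[OF p D(1,2,5,6,7,9)]
  show thesis
  proof (rule that[of ?u])
    fix c :: "'m \<Rightarrow> int \<Rightarrow> 'a \<Rightarrow> 'a" and m y assume y: "y \<in> el (fiber_prod C f g) m"
    show "c g m y = at c g' f' f g m (fmap F ?u m y)"
      using u y fiber_prod_src[OF p] coop_at_cong[OF s p, of ?u y m c] coop_at_pr[OF p y, of c] by simp
  qed (use u fiber_prod_src[OF p] in auto)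
qed

lemma coop_at_hom:
  assumes c: "c \<in> coop_carrier C F f i" and s: "sq g' f' f g"
  shows "at c g' f' f g m \<in> hom (gr F (src C g') m) (gr F (src C g) (m + i))"
proof -
  note D = fiber_squareD[OF s]
  have p: "sq (pr1 C f g) (pr2 C f g) f g" using D by (intro fiber_square_pr) auto
  note P = fiber_squareD[OF p]
  let ?v = "mediating C g' f' (pr1 C f g) (pr2 C f g)"
  note v = fiber_square_mediating[OF s P(1,2,5,6,7,9)]
  have "fmap F ?v m \<in> hom (gr F (src C g') m) (gr F (fiber_prod C f g) m)"
    using fmap_hom[of ?v m] v fiber_prod_src[OF p] by simp
  moreover have "c g m \<in> hom (gr F (fiber_prod C f g) m) (gr F (src C g) (m + i))"
    using c D by (auto simp: coop_carrier_def arr_to_def)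
  ultimately have "c g m \<circ> fmap F ?v m \<in> hom (gr F (src C g') m) (gr F (src C g) (m + i))"
    by (rule hom_compose)
  then show ?thesis by (simp add: coop_at_def[abs_def] o_def)
qed

lemma coop_at_in:
  assumes "c \<in> coop_carrier C F f i" "sq g' f' f g" "x \<in> el (src C g') m"
  shows "at c g' f' f g m x \<in> el (src C g) (m + i)"
  using coop_at_hom[OF assms(1,2), of m] assms(3) by (auto simp: hom_def)

lemma coop_family_apply:
  "\<lbrakk>g \<in> arr_to C (tgt C f); x \<in> el (fiber_prod C f g) m\<rbrakk> \<Longrightarrow> coop_family C F f c g m x = c g m x"
  by (simp add: coop_family_def)

lemma coop_apply_closed:
  "\<lbrakk>c \<in> coop_carrier C F f i; g \<in> arr_to C (tgt C f); x \<in> el (fiber_prod C f g) m\<rbrakk>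
    \<Longrightarrow> c g m x \<in> el (src C g) (m + i)"
  unfolding coop_carrier_def hom_def by fast

text \<open>The restriction in \<open>coop_family\<close> is invisible here, since \<open>at\<close>
  feeds the family an arrow to \<open>tgt C f\<close> and an element over the chosen product. The
  operations can thus be evaluated before their results are known to be co-operations.\<close>

lemma coop_at_family:
  assumes s: "sq g' f' f g" and x: "x \<in> el (src C g') m"
  shows "at (coop_family C F f c) g' f' f g m x = at c g' f' f g m x"
proof -
  note D = fiber_squareD[OF s]
  have p: "sq (pr1 C f g) (pr2 C f g) f g" using D by (intro fiber_square_pr) auto
  note P = fiber_squareD[OF p]
  note v = fiber_square_mediating[OF s P(1,2,5,6,7,9)]
  show ?thesis
    using v x D fiber_prod_src[OF p] unfolding coop_at_def
    by (intro coop_family_apply fmap_closed' arr_toI) auto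
qed

lemma coop_apply_eqI:
  assumes "c \<in> coop_carrier C F f i" "d \<in> coop_carrier C F f i"
    and eq: "\<And>g m x. \<lbrakk>g \<in> arr_to C (tgt C f); x \<in> el (fiber_prod C f g) m\<rbrakk> \<Longrightarrow> c g m x = d g m x"
  shows "c = d"
proof (rule extensionalityI)
  show "c \<in> extensional (arr_to C (tgt C f))" "d \<in> extensional (arr_to C (tgt C f))"
    using assms by (auto simp: coop_carrier_def)
  fix g assume g: "g \<in> arr_to C (tgt C f)"
  show "c g = d g"
  proof
    \<comment> \<open>The degree ranges over all integers without restriction, so plain function
      extensionality handles this layer.\<close>
    fix m show "c g m = d g m"
      using assms g eq[OF g]
      by - (rule extensionalityI[of _ "el (fiber_prod C f g) m"]; auto simp: coop_carrier_def)
  qed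
qed

lemma coop_eqI:
  assumes c: "c \<in> coop_carrier C F f i" "d \<in> coop_carrier C F f i"
    and eq: "\<And>g. g \<in> arr_to C (tgt C f) \<Longrightarrow> \<exists>g' f'. sq g' f' f g \<and>
      (\<forall>m. \<forall>x \<in> el (src C g') m. at c g' f' f g m x = at d g' f' f g m x)"
  shows "c = d"
proof (rule coop_apply_eqI[OF c])
  fix g m x assume g: "g \<in> arr_to C (tgt C f)" and x: "x \<in> el (fiber_prod C f g) m"
  obtain g' f' where s: "sq g' f' f g"
    and e: "\<forall>m. \<forall>x \<in> el (src C g') m. at c g' f' f g m x = at d g' f' f g m x"
    using eq[OF g] by blast
  obtain u where u: "u \<in> arr C" "src C u = src C g'" "tgt C u = fiber_prod C f g"
    "\<And>c m y. y \<in> el (fiber_prod C f g) m \<Longrightarrow> c g m y = at c g' f' f g m (fmap F u m y)"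
    using coop_at_eq_apply[OF s] by blast
  show "c g m x = d g m x"
    unfolding u(4)[OF x, of c] u(4)[OF x, of d] using e fmap_closed'[OF u(1) x u(3,2)] by blast
qed

lemma comm_group_gr_src: "g \<in> arr C \<Longrightarrow> comm_group (gr F (src C g) m)"
  by (simp add: group_gr src_obj)

text \<open>The values at products agree as well because the carrier is closed under multiplication.
  Formulas for \<open>at\<close> are available on carriers only, so equality of functions cannot be
  used instead.\<close>

lemma hom_gr_cong:
  assumes "X \<in> obj C" "k \<in> hom (gr F X m) H" "\<And>x. x \<in> el X m \<Longrightarrow> k' x = k x"
  shows "k' \<in> hom (gr F X m) H"
proof -
  interpret comm_group "gr F X m" by (rule group_gr) fact
  show ?thesis using assms(2,3) by (auto simp: hom_def Pi_iff)
qed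

text \<open>One convenient square per arrow is enough: \<open>c g m\<close> is \<open>at\<close>
  preceded by a restriction, which settles the homomorphism property, and
  \<open>coop_at_fmap_transfer\<close> moves compatibility to the chosen squares. The form
  \<open>coop_family C F f c0\<close> provides extensionality in the arrow and in the
  element.\<close>

lemma coop_carrierI:
  assumes f: "f \<in> arr C" and c: "c = coop_family C F f c0"
    and hom: "\<And>g m. g \<in> arr_to C (tgt C f) \<Longrightarrow> \<exists>g' f'. sq g' f' f g \<and>
      at c g' f' f g m \<in> hom (gr F (src C g') m) (gr F (src C g) (m + i))"
    and compat: "\<And>g h m. \<lbrakk>g \<in> arr_to C (tgt C f); h \<in> arr_to C (src C g)\<rbrakk> \<Longrightarrow>
      \<exists>g' f' h' f''. sq g' f' f g \<and> sq h' f'' f' h \<and> (\<forall>x \<in> el (src C g') m.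
        at c (g' \<cdot> h') f'' f (g \<cdot> h) m (fmap F h' m x) = fmap F h (m + i) (at c g' f' f g m x))"
  shows "c \<in> coop_carrier C F f i"
proof -
  have "c g m \<in> hom (gr F (fiber_prod C f g) m) (gr F (src C g) (m + i))"
    if g: "g \<in> arr_to C (tgt C f)" for g m
  proof -
    obtain g' f' where s: "sq g' f' f g"
      and e: "at c g' f' f g m \<in> hom (gr F (src C g') m) (gr F (src C g) (m + i))"
      using hom[OF g] by blast
    note p = sq_pr[OF f g]
    note D = fiber_squareD[OF s] and P = fiber_squareD[OF p]
    let ?u = "mediating C (pr1 C f g) (pr2 C f g) g' f'"
    note u = fiber_square_mediating[OF p D(1,2,5,6,7,9)]
    have "fmap F ?u m \<in> hom (gr F (fiber_prod C f g) m) (gr F (src C g') m)"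
      using fmap_hom[of ?u m] u fiber_prod_src[OF p] by simp
    from hom_compose[OF this e] show ?thesis
      using u fiber_prod_src[OF p] coop_at_cong[OF s p, of ?u _ m c] coop_at_pr[OF p, of _ m c] P
      by - (rule hom_gr_cong[of _ "at c g' f' f g m \<circ> fmap F ?u m"]; auto simp: src_obj)
  qed
  moreover have "coop_compatible C F f i c"
    unfolding coop_compatible_def Let_def
  proof (intro ballI allI)
    fix g h m x assume g: "g \<in> arr_to C (tgt C f)" and h: "h \<in> arr_to C (src C g)"
      and x: "x \<in> el (fiber_prod C f g) m"
    note p = sq_pr[OF f g]
    note P = fiber_squareD[OF p]
    have q: "sq (pr1 C (pr2 C f g) h) (pr2 C (pr2 C f g) h) (pr2 C f g) h"
      using h P by (intro sq_pr) auto
    obtain g' f' h' f'' where s: "sq g' f' f g" "sq h' f'' f' h" and e: "\<forall>x \<in> el (src C g') m.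
        at c (g' \<cdot> h') f'' f (g \<cdot> h) m (fmap F h' m x) = fmap F h (m + i) (at c g' f' f g m x)"
      using compat[OF g h] by blast
    show "at c (pr1 C f g \<cdot> pr1 C (pr2 C f g) h) (pr2 C (pr2 C f g) h) f (g \<cdot> h) m
        (fmap F (pr1 C (pr2 C f g) h) m x) = fmap F h (m + i) (c g m x)"
      using coop_at_fmap_transfer[OF s p q, of m c "m + i" x] e x
      by (simp add: coop_at_pr[OF p x] fiber_prod_src[OF p])
  qed
  ultimately show ?thesis
    by (auto simp: coop_carrier_def c coop_family_def)
qed

lemma sq_obtain:
  assumes "f \<in> arr C" "g \<in> arr_to C (tgt C f)"
  obtains g' f' where "sq g' f' f g"
  using sq_pr[OF assms] by blast

lemma sq_obtain2:
  assumes "f \<in> arr C" "g \<in> arr C" "tgt C f = src C g" "h \<in> arr_to C (tgt C g)"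
  obtains h' g' h'' f' where "sq h' g' g h" "sq h'' f' f h'"
proof -
  obtain h' g' where s: "sq h' g' g h" using sq_obtain assms by blast
  obtain h'' f' where "sq h'' f' f h'"
    using sq_obtain[of f h'] fiber_squareD[OF s] assms by (auto simp: arr_to_def)
  with s show thesis using that by blast
qed

section \<open>The groups of co-operations\<close>

lemma fmap_group_hom: "f \<in> arr C \<Longrightarrow> group_hom (gr F (tgt C f) m) (gr F (src C f) m) (fmap F f m)"
  by (intro group_hom.intro group_hom_axioms.intro fmap_hom comm_group.axioms group_gr src_obj tgt_obj)

lemma carrier_coop_group [simp]: "carrier (coop_group C F f i) = coop_carrier C F f i"
  by (simp add: coop_group_def)

text \<open>Serves multiplication and inversion at once. The homomorphism property is what
  \<open>op_hom\<close> asks for; compatibility follows from the naturality \<open>op_fmap\<close>,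
  since \<open>c\<close> and \<open>d\<close> are compatible separately.\<close>

lemma coop_family_pointwise_in:
  assumes f: "f \<in> arr C" and c: "c \<in> coop_carrier C F f i" and d: "d \<in> coop_carrier C F f i"
    and op_hom: "\<And>X n (G :: 'a monoid) \<phi> \<psi>. \<lbrakk>X \<in> obj C; \<phi> \<in> hom G (gr F X n); \<psi> \<in> hom G (gr F X n)\<rbrakk>
      \<Longrightarrow> (\<lambda>x. op X n (\<phi> x) (\<psi> x)) \<in> hom G (gr F X n)"
    and op_fmap: "\<And>h n a b. \<lbrakk>h \<in> arr C; a \<in> el (tgt C h) n; b \<in> el (tgt C h) n\<rbrakk>
      \<Longrightarrow> op (src C h) n (fmap F h n a) (fmap F h n b) = fmap F h n (op (tgt C h) n a b)"
  shows "coop_family C F f (\<lambda>g m x. op (src C g) (m + i) (c g m x) (d g m x)) \<in> coop_carrier C F f i"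
    (is "coop_family C F f ?e \<in> _")
proof (rule coop_carrierI[OF f refl])
  have at: "at (coop_family C F f ?e) g' f' f g m x = op (src C g) (m + i) (at c g' f' f g m x) (at d g' f' f g m x)"
    if "sq g' f' f g" "x \<in> el (src C g') m" for g' f' g m x
    unfolding coop_at_family[OF that] by (simp add: coop_at_def)
  fix g m assume g: "g \<in> arr_to C (tgt C f)"
  obtain g' f' where s: "sq g' f' f g" using sq_obtain[OF f g] by blast
  note D = fiber_squareD[OF s]
  have "at (coop_family C F f ?e) g' f' f g m \<in> hom (gr F (src C g') m) (gr F (src C g) (m + i))"
    using at[OF s] D
    by - (rule hom_gr_cong[OF _ op_hom[OF _ coop_at_hom[OF c s] coop_at_hom[OF d s]]]; auto simp: src_obj)
  with s show "\<exists>g' f'. sq g' f' f g \<and>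
      at (coop_family C F f ?e) g' f' f g m \<in> hom (gr F (src C g') m) (gr F (src C g) (m + i))"
    by blast
  fix h assume h: "h \<in> arr_to C (src C g)"
  obtain h' f'' where t: "sq h' f'' f' h" using sq_obtain[of f' h] D h by auto
  note E = fiber_squareD[OF t]
  have "at (coop_family C F f ?e) (g' \<cdot> h') f'' f (g \<cdot> h) m (fmap F h' m x) =
      fmap F h (m + i) (at (coop_family C F f ?e) g' f' f g m x)" if x: "x \<in> el (src C g') m" for x
  proof -
    have x': "fmap F h' m x \<in> el (src C (g' \<cdot> h')) m"
      using x D E by (intro fmap_closed') (auto simp: src_comp)
    have "at (coop_family C F f ?e) (g' \<cdot> h') f'' f (g \<cdot> h) m (fmap F h' m x) =
        op (src C h) (m + i) (fmap F h (m + i) (at c g' f' f g m x)) (fmap F h (m + i) (at d g' f' f g m x))"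
      using at[OF fiber_square_paste[OF s t] x'] coop_at_fmap[OF c s t x] coop_at_fmap[OF d s t x] D E
      by (simp add: src_comp)
    also have "\<dots> = fmap F h (m + i) (at (coop_family C F f ?e) g' f' f g m x)"
      using op_fmap[of h "at c g' f' f g m x" "m + i" "at d g' f' f g m x"]
        coop_at_in[OF c s x] coop_at_in[OF d s x] at[OF s x] D E by simp
    finally show ?thesis .
  qed
  with s t show "\<exists>g' f' h' f''. sq g' f' f g \<and> sq h' f'' f' h \<and> (\<forall>x \<in> el (src C g') m.
      at (coop_family C F f ?e) (g' \<cdot> h') f'' f (g \<cdot> h) m (fmap F h' m x) =
      fmap F h (m + i) (at (coop_family C F f ?e) g' f' f g m x))"
    by blast
qed

lemma coop_mult_in:
  assumes f: "f \<in> arr C" and c: "c \<in> coop_carrier C F f i" and d: "d \<in> coop_carrier C F f i"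
  shows "c \<otimes>\<^bsub>coop_group C F f i\<^esub> d \<in> coop_carrier C F f i"
  unfolding coop_group_def monoid.simps
proof (rule coop_family_pointwise_in[OF f c d])
  fix X n and G :: "'a monoid" and \<phi> \<psi>
  assume X: "X \<in> obj C" and *: "\<phi> \<in> hom G (gr F X n)" "\<psi> \<in> hom G (gr F X n)"
  interpret comm_group "gr F X n" using X by (rule group_gr)
  \<comment> \<open>Commutativity enters here: over a nonabelian group a pointwise product of
    homomorphisms need not be a homomorphism.\<close>
  from * show "(\<lambda>x. \<phi> x \<otimes>\<^bsub>gr F X n\<^esub> \<psi> x) \<in> hom G (gr F X n)"
    by (auto simp: hom_def Pi_iff m_ac)
next
  fix h n a b assume h: "h \<in> arr C" "a \<in> el (tgt C h) n" "b \<in> el (tgt C h) n"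
  then interpret group_hom "gr F (tgt C h) n" "gr F (src C h) n" "fmap F h n"
    by (intro fmap_group_hom)
  show "fmap F h n a \<otimes>\<^bsub>gr F (src C h) n\<^esub> fmap F h n b = fmap F h n (a \<otimes>\<^bsub>gr F (tgt C h) n\<^esub> b)"
    using h by simp
qed

lemma coop_inv_in:
  assumes f: "f \<in> arr C" and c: "c \<in> coop_carrier C F f i"
  shows "coop_family C F f (\<lambda>g m x. inv\<^bsub>gr F (src C g) (m + i)\<^esub> c g m x) \<in> coop_carrier C F f i"
\<comment> \<open>Inversion is unary, so the second slot of \<open>op\<close> is a dummy, filled
  with \<open>c\<close> again.\<close>
proof (rule coop_family_pointwise_in[OF f c c, where op = "\<lambda>X n a b. inv\<^bsub>gr F X n\<^esub> a"])
  fix X n and G :: "'a monoid" and \<phi> \<psi>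
  assume X: "X \<in> obj C" and *: "\<phi> \<in> hom G (gr F X n)"
  interpret comm_group "gr F X n" using X by (rule group_gr)
  from * show "(\<lambda>x. inv\<^bsub>gr F X n\<^esub> \<phi> x) \<in> hom G (gr F X n)"
    by (auto simp: hom_def Pi_iff inv_mult)
next
  fix h n a b assume h: "h \<in> arr C" "a \<in> el (tgt C h) n"
  then interpret group_hom "gr F (tgt C h) n" "gr F (src C h) n" "fmap F h n"
    by (intro fmap_group_hom)
  show "inv\<^bsub>gr F (src C h) n\<^esub> fmap F h n a = fmap F h n (inv\<^bsub>gr F (tgt C h) n\<^esub> a)"
    using h by simp
qed

text \<open>\<open>coop_family_pointwise_in\<close> combines members that are already given, so the
  constant family is checked directly; its compatibility says that the maps of \<open>F\<close>
  preserve units.\<close>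

lemma coop_one_in:
  assumes f: "f \<in> arr C"
  shows "\<one>\<^bsub>coop_group C F f i\<^esub> \<in> coop_carrier C F f i" (is "?e \<in> _")
proof (rule coop_carrierI[OF f])
  show "?e = coop_family C F f (\<lambda>g m x. \<one>\<^bsub>gr F (src C g) (m + i)\<^esub>)"
    by (simp add: coop_group_def)
  have at: "at ?e g' f' f g m x = \<one>\<^bsub>gr F (src C g) (m + i)\<^esub>"
    if "sq g' f' f g" "x \<in> el (src C g') m" for g' f' g m x
    using coop_at_family[OF that] by (simp add: coop_at_def coop_group_def)
  fix g m assume g: "g \<in> arr_to C (tgt C f)"
  obtain g' f' where s: "sq g' f' f g" using sq_obtain[OF f g] by blast
  note D = fiber_squareD[OF s]
  interpret G: comm_group "gr F (src C g) (m + i)" using D by (intro comm_group_gr_src)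
  have "at ?e g' f' f g m \<in> hom (gr F (src C g') m) (gr F (src C g) (m + i))"
    using at[OF s] D
    by - (rule hom_gr_cong[of _ "\<lambda>x. \<one>\<^bsub>gr F (src C g) (m + i)\<^esub>"]; auto simp: src_obj hom_def)
  with s show "\<exists>g' f'. sq g' f' f g \<and>
      at ?e g' f' f g m \<in> hom (gr F (src C g') m) (gr F (src C g) (m + i))"
    by blast
  fix h assume h: "h \<in> arr_to C (src C g)"
  obtain h' f'' where t: "sq h' f'' f' h" using sq_obtain[of f' h] D h by auto
  note E = fiber_squareD[OF t]
  interpret H: group_hom "gr F (tgt C h) (m + i)" "gr F (src C h) (m + i)" "fmap F h (m + i)"
    using E by (intro fmap_group_hom)
  have "at ?e (g' \<cdot> h') f'' f (g \<cdot> h) m (fmap F h' m x) = fmap F h (m + i) (at ?e g' f' f g m x)"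
    if x: "x \<in> el (src C g') m" for x
  proof -
    have x': "fmap F h' m x \<in> el (src C (g' \<cdot> h')) m"
      using x D E by (intro fmap_closed') (auto simp: src_comp)
    show ?thesis
      using at[OF s x] at[OF fiber_square_paste[OF s t] x'] H.hom_one D E by (simp add: src_comp)
  qed
  with s t show "\<exists>g' f' h' f''. sq g' f' f g \<and> sq h' f'' f' h \<and> (\<forall>x \<in> el (src C g') m.
      at ?e (g' \<cdot> h') f'' f (g \<cdot> h) m (fmap F h' m x) = fmap F h (m + i) (at ?e g' f' f g m x))"
    by blast
qed

lemma coop_mult_apply:
  "\<lbrakk>g \<in> arr_to C (tgt C f); x \<in> el (fiber_prod C f g) m\<rbrakk> \<Longrightarrow>
    (c \<otimes>\<^bsub>coop_group C F f i\<^esub> d) g m x = c g m x \<otimes>\<^bsub>gr F (src C g) (m + i)\<^esub> d g m x"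
  by (simp add: coop_group_def coop_family_apply)

lemma coop_one_apply:
  "\<lbrakk>g \<in> arr_to C (tgt C f); x \<in> el (fiber_prod C f g) m\<rbrakk> \<Longrightarrow>
    \<one>\<^bsub>coop_group C F f i\<^esub> g m x = \<one>\<^bsub>gr F (src C g) (m + i)\<^esub>"
  by (simp add: coop_group_def coop_family_apply)

lemma coop_at_mult:
  "\<lbrakk>sq g' f' f g; x \<in> el (src C g') m\<rbrakk> \<Longrightarrow> at (c \<otimes>\<^bsub>coop_group C F f i\<^esub> d) g' f' f g m x =
    at c g' f' f g m x \<otimes>\<^bsub>gr F (src C g) (m + i)\<^esub> at d g' f' f g m x"
  using coop_at_family[of g' f' f g x m "\<lambda>g m x. c g m x \<otimes>\<^bsub>gr F (src C g) (m + i)\<^esub> d g m x"]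
  by (simp add: coop_group_def coop_at_def)

lemma comm_group_coop:
  assumes f: "f \<in> arr C"
  shows "comm_group (coop_group C F f i)"
proof (rule comm_groupI)
  note G = comm_group_gr_src[OF arr_toD(1)]
  note in_gr = coop_apply_closed
  show "\<one>\<^bsub>coop_group C F f i\<^esub> \<in> carrier (coop_group C F f i)"
    using coop_one_in[OF f] by simp
  fix x assume x: "x \<in> carrier (coop_group C F f i)"
  show "\<one>\<^bsub>coop_group C F f i\<^esub> \<otimes>\<^bsub>coop_group C F f i\<^esub> x = x"
  proof (rule coop_apply_eqI)
    fix g m a assume g: "g \<in> arr_to C (tgt C f)" and a: "a \<in> el (fiber_prod C f g) m"
    interpret G: comm_group "gr F (src C g) (m + i)" by (rule G[OF g])
    show "(\<one>\<^bsub>coop_group C F f i\<^esub> \<otimes>\<^bsub>coop_group C F f i\<^esub> x) g m a = x g m a"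
      using g a x in_gr[of x f i g a m] by (simp add: coop_mult_apply coop_one_apply)
  qed (use f x in \<open>auto intro: coop_mult_in coop_one_in\<close>)
  let ?y = "coop_family C F f (\<lambda>g m a. inv\<^bsub>gr F (src C g) (m + i)\<^esub> x g m a)"
  have "?y \<otimes>\<^bsub>coop_group C F f i\<^esub> x = \<one>\<^bsub>coop_group C F f i\<^esub>"
  proof (rule coop_apply_eqI)
    fix g m a assume g: "g \<in> arr_to C (tgt C f)" and a: "a \<in> el (fiber_prod C f g) m"
    interpret G: comm_group "gr F (src C g) (m + i)" by (rule G[OF g])
    show "(?y \<otimes>\<^bsub>coop_group C F f i\<^esub> x) g m a = \<one>\<^bsub>coop_group C F f i\<^esub> g m a"
      using g a x in_gr[of x f i g a m] by (simp add: coop_mult_apply coop_one_apply coop_family_apply)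
  qed (use f x in \<open>auto intro: coop_mult_in coop_one_in coop_inv_in\<close>)
  then show "\<exists>y\<in>carrier (coop_group C F f i). y \<otimes>\<^bsub>coop_group C F f i\<^esub> x = \<one>\<^bsub>coop_group C F f i\<^esub>"
    using f x by (auto intro: coop_inv_in)
  fix y assume y: "y \<in> carrier (coop_group C F f i)"
  show "x \<otimes>\<^bsub>coop_group C F f i\<^esub> y \<in> carrier (coop_group C F f i)"
    using f x y by (auto intro: coop_mult_in)
  show "x \<otimes>\<^bsub>coop_group C F f i\<^esub> y = y \<otimes>\<^bsub>coop_group C F f i\<^esub> x"
  proof (rule coop_apply_eqI)
    fix g m a assume g: "g \<in> arr_to C (tgt C f)" and a: "a \<in> el (fiber_prod C f g) m"
    interpret G: comm_group "gr F (src C g) (m + i)" by (rule G[OF g])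
    show "(x \<otimes>\<^bsub>coop_group C F f i\<^esub> y) g m a = (y \<otimes>\<^bsub>coop_group C F f i\<^esub> x) g m a"
      using g a x y in_gr[of x f i g a m] in_gr[of y f i g a m] by (simp add: coop_mult_apply G.m_comm)
  qed (use f x y in \<open>auto intro: coop_mult_in\<close>)
  fix z assume z: "z \<in> carrier (coop_group C F f i)"
  show "(x \<otimes>\<^bsub>coop_group C F f i\<^esub> y) \<otimes>\<^bsub>coop_group C F f i\<^esub> z =
      x \<otimes>\<^bsub>coop_group C F f i\<^esub> (y \<otimes>\<^bsub>coop_group C F f i\<^esub> z)"
  proof (rule coop_apply_eqI)
    fix g m a assume g: "g \<in> arr_to C (tgt C f)" and a: "a \<in> el (fiber_prod C f g) m"
    interpret G: comm_group "gr F (src C g) (m + i)" by (rule G[OF g])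
    show "((x \<otimes>\<^bsub>coop_group C F f i\<^esub> y) \<otimes>\<^bsub>coop_group C F f i\<^esub> z) g m a =
        (x \<otimes>\<^bsub>coop_group C F f i\<^esub> (y \<otimes>\<^bsub>coop_group C F f i\<^esub> z)) g m a"
      using g a x y z in_gr[of x f i g a m] in_gr[of y f i g a m] in_gr[of z f i g a m]
      by (simp add: coop_mult_apply G.m_assoc)
  qed (use f x y z in \<open>auto intro: coop_mult_in\<close>)
qed

section \<open>The operations on arbitrary fiber squares\<close>

text \<open>The definition evaluates \<open>c\<close> over the chosen projection \<open>H\<close>,
  the right-hand side over \<open>h'\<close>. The comparison \<open>v\<close> of these projections
  and the arrow \<open>k\<close> above it belong to a fiber square, so compatibility of
  \<open>c\<close> trades restriction along \<open>k\<close> before \<open>c\<close> for restriction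
  along \<open>v\<close> after it. The latter is what \<open>at\<close> does before applying
  \<open>d\<close>.\<close>

lemma coop_at_prod:
  assumes c: "c \<in> coop_carrier C F f i" and s: "sq h' g' g h" and t: "sq h'' f' f h'"
    and x: "x \<in> el (src C h'') m"
  shows "at (coop_prod C F f g i j c d) h'' (g' \<cdot> f') (g \<cdot> f) h m x =
    at d h' g' g h (m + i) (at c h'' f' f h' m x)"
proof -
  note D = fiber_squareD[OF s] and E = fiber_squareD[OF t]
  note st = fiber_square_paste_vertical[OF s t]
  define H G where "H = pr1 C g h" and "G = pr2 C g h"
  have p: "sq H G g h" unfolding H_def G_def using D by (intro fiber_square_pr) auto
  note P = fiber_squareD[OF p]
  define K L where "K = pr1 C f H" and "L = pr2 C f H"
  have q0: "sq (pr1 C f H) (pr2 C f H) f H" using P D E by (intro fiber_square_pr) auto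
  then have q: "sq K L f H" unfolding K_def L_def .
  note Q = fiber_squareD[OF q]
  note pq = fiber_square_paste_vertical[OF p q]
  define R S where "R = pr1 C (g \<cdot> f) h" and "S = pr2 C (g \<cdot> f) h"
  have r: "sq R S (g \<cdot> f) h"
    unfolding R_def S_def using fiber_squareD[OF st] by (intro fiber_square_pr) auto
  note U = fiber_squareD[OF r] and V = fiber_squareD[OF pq]
  define u where "u = mediating C h'' (g' \<cdot> f') R S"
  have u: "u \<in> arr C" "src C u = src C R" "tgt C u = src C h''" "h'' \<cdot> u = R" "(g' \<cdot> f') \<cdot> u = S"
    unfolding u_def using fiber_square_mediating[OF st U(1,2,5,6,7,9)] by auto
  define w where "w = mediating C R S K (G \<cdot> L)"
  have w: "w \<in> arr C" "src C w = src C K" "tgt C w = src C R" "R \<cdot> w = K" "S \<cdot> w = G \<cdot> L"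
    unfolding w_def using fiber_square_mediating[OF r V(1,2,5,6,7,9)] by auto
  define v where "v = mediating C h' g' H G"
  have v: "v \<in> arr C" "src C v = src C H" "tgt C v = src C h'" "h' \<cdot> v = H" "g' \<cdot> v = G"
    unfolding v_def using fiber_square_mediating[OF s P(1,2,5,6,7,9)] by auto
  \<comment> \<open>The chosen product of \<open>g \<cdot> f\<close> and \<open>h\<close> lies
    between \<open>w\<close> and \<open>u\<close> and drops out: \<open>k\<close> goes directly from
    the chosen stack to the given one.\<close>
  define k where "k = u \<cdot> w"
  have k: "k \<in> arr C" "src C k = src C K" "tgt C k = src C h''" "h'' \<cdot> k = K"
    unfolding k_def using u w E by (auto simp: comp_arr src_comp tgt_comp comp_comp_eq[OF u(4)])
  have gfk: "(g' \<cdot> f') \<cdot> k = G \<cdot> L"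
    unfolding k_def using u w D E
    by (simp add: comp_comp_eq[OF u(5)] comp_arr src_comp tgt_comp)
  have fk: "f' \<cdot> k = v \<cdot> L"
  proof (rule fiber_square_unique[OF s])
    show "h' \<cdot> (f' \<cdot> k) = h' \<cdot> (v \<cdot> L)"
      using fiber_square_comp[OF t k(1,3)] k v Q D P by (simp add: comp_comp_eq[OF v(4)])
    show "g' \<cdot> (f' \<cdot> k) = g' \<cdot> (v \<cdot> L)"
      using gfk k v Q D P E by (simp add: comp_comp_eq[OF v(5)] comp_assoc)
  qed (use k v D E P Q in \<open>auto simp: comp_arr src_comp tgt_comp\<close>)
  \<comment> \<open>Since \<open>h'' \<cdot> k = K\<close> and \<open>h' \<cdot> v = H\<close>, the
    chosen square \<open>q\<close> is a rectangle from which \<open>t\<close> can be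
    cancelled.\<close>
  have kL: "sq k L f' v"
    using k v q fk D E by (intro fiber_square_cancel[OF t]) auto
  have x2: "fmap F k m x \<in> el (fiber_prod C f H) m"
    unfolding fiber_prod_src[OF q0] K_def[symmetric] using k x by (intro fmap_closed') auto
  have "at (coop_prod C F f g i j c d) h'' (g' \<cdot> f') (g \<cdot> f) h m x =
      d h (m + i) (c H m (fmap F w m (fmap F u m x)))"
    unfolding coop_prod_def coop_at_family[OF st x]
    by (simp add: coop_at_def Let_def u_def w_def H_def G_def K_def L_def R_def S_def)
  also have "fmap F w m (fmap F u m x) = fmap F k m x"
    unfolding k_def using u w x by (intro fmap_comp[symmetric]) auto
  also have "c H m (fmap F k m x) = at c K L f H m (fmap F k m x)"
    unfolding K_def L_def using coop_at_pr[OF q0 x2] by simp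
  also have "\<dots> = fmap F v (m + i) (at c h'' f' f h' m x)"
    using coop_at_fmap[OF c t kL x] k v by simp
  finally show ?thesis
    by (simp add: coop_at_def[of C F d] v_def H_def G_def)
qed

text \<open>Any stack leads to the value of \<open>c\<close> over the same arrow \<open>h\<close>,
  so the comparison \<open>k\<close> of two stacks enters only through
  \<open>coop_at_cong\<close>.\<close>

lemma coop_at_push:
  assumes s: "sq h' g' g h" and t: "sq h'' f' f h'" and x: "x \<in> el (src C h') m"
  shows "at (coop_push C F f g i c) h' g' g h m x = at c h'' (g' \<cdot> f') (g \<cdot> f) h m (fmap F f' m x)"
proof -
  note D = fiber_squareD[OF s] and E = fiber_squareD[OF t]
  note st = fiber_square_paste_vertical[OF s t]
  define H G where "H = pr1 C g h" and "G = pr2 C g h"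
  have p: "sq H G g h" unfolding H_def G_def using D by (intro fiber_square_pr) auto
  note P = fiber_squareD[OF p]
  define K L where "K = pr1 C f H" and "L = pr2 C f H"
  have q: "sq K L f H" unfolding K_def L_def using P D E by (intro fiber_square_pr) auto
  note Q = fiber_squareD[OF q]
  note pq = fiber_square_paste_vertical[OF p q]
  define v where "v = mediating C h' g' H G"
  have v: "v \<in> arr C" "src C v = src C H" "tgt C v = src C h'" "h' \<cdot> v = H" "g' \<cdot> v = G"
    unfolding v_def using fiber_square_mediating[OF s P(1,2,5,6,7,9)] by auto
  have eq: "f \<cdot> K = h' \<cdot> (v \<cdot> L)" using v Q D P by (simp add: comp_comp_eq[OF v(4)])
  define k where "k = mediating C h'' f' K (v \<cdot> L)"
  have k: "k \<in> arr C" "src C k = src C K" "tgt C k = src C h''" "h'' \<cdot> k = K" "f' \<cdot> k = v \<cdot> L"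
    unfolding k_def using fiber_square_mediating[OF t, of K "v \<cdot> L"] eq v D P Q E
    by (auto simp: comp_arr src_comp tgt_comp)
  have gfk: "(g' \<cdot> f') \<cdot> k = G \<cdot> L"
    using k v Q D P E by (simp add: comp_comp_eq[OF v(5)] comp_assoc)
  have "at (coop_push C F f g i c) h' g' g h m x =
      at c K (G \<cdot> L) (g \<cdot> f) h m (fmap F L m (fmap F v m x))"
    unfolding coop_push_def coop_at_family[OF s x]
    by (simp add: coop_at_def Let_def v_def H_def G_def K_def L_def)
  also have "fmap F L m (fmap F v m x) = fmap F (v \<cdot> L) m x"
    using v P Q x by (intro fmap_comp[symmetric]) auto
  also have "\<dots> = fmap F k m (fmap F f' m x)"
    unfolding k(5)[symmetric] using k E x by (intro fmap_comp) auto
  also have "at c K (G \<cdot> L) (g \<cdot> f) h m \<dots> = at c h'' (g' \<cdot> f') (g \<cdot> f) h m (fmap F f' m x)"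
    using k gfk E x by (intro coop_at_cong[OF pq st] fmap_closed') auto
  finally show ?thesis .
qed

text \<open>The value is taken over \<open>g \<cdot> h\<close> for every model; \<open>v\<close>
  compares the chosen model with the given one.\<close>

lemma coop_at_pull:
  assumes s: "sq g' f' f g" and t: "sq h' f'' f' h" and x: "x \<in> el (src C h') m"
  shows "at (coop_pull C F g' f' f g i c) h' f'' f' h m x = at c (g' \<cdot> h') f'' f (g \<cdot> h) m x"
proof -
  note D = fiber_squareD[OF s] and E = fiber_squareD[OF t]
  define H G where "H = pr1 C f' h" and "G = pr2 C f' h"
  have p: "sq H G f' h" unfolding H_def G_def using E by (intro fiber_square_pr) auto
  note P = fiber_squareD[OF p]
  define v where "v = mediating C h' f'' H G"
  have v: "v \<in> arr C" "src C v = src C H" "tgt C v = src C h'" "h' \<cdot> v = H" "f'' \<cdot> v = G"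
    unfolding v_def using fiber_square_mediating[OF t P(1,2,5,6,7,9)] by auto
  have "at (coop_pull C F g' f' f g i c) h' f'' f' h m x = at c (g' \<cdot> H) G f (g \<cdot> h) m (fmap F v m x)"
    unfolding coop_pull_def coop_at_family[OF t x]
    by (simp add: coop_at_def Let_def v_def H_def G_def)
  also have "\<dots> = at c (g' \<cdot> h') f'' f (g \<cdot> h) m x"
    using v D E P x comp_assoc[of v h' g']
    by (intro coop_at_cong[OF fiber_square_paste[OF s p] fiber_square_paste[OF s t]]) (auto simp: src_comp)
  finally show ?thesis .
qed

section \<open>Closure of co-operations under product, pushforward and pullback\<close>

lemma coop_prod_in:
  assumes f: "f \<in> arr C" and g: "g \<in> arr C" and fg: "tgt C f = src C g"
    and c: "c \<in> coop_carrier C F f i" and d: "d \<in> coop_carrier C F g j"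
  shows "coop_prod C F f g i j c d \<in> coop_carrier C F (g \<cdot> f) (i + j)" (is "?e \<in> _")
proof (rule coop_carrierI)
  show "g \<cdot> f \<in> arr C" using f g fg by (simp add: comp_arr)
  show "?e = coop_family C F (g \<cdot> f) (\<lambda>h m x.
       let h' = pr1 C g h; g' = pr2 C g h;
           w = mediating C (pr1 C (g \<cdot> f) h) (pr2 C (g \<cdot> f) h) (pr1 C f h') (g' \<cdot> pr2 C f h')
       in d h (m + i) (c h' m (fmap F w m x)))"
    by (rule coop_prod_def)
  fix h m assume "h \<in> arr_to C (tgt C (g \<cdot> f))"
  then have h: "h \<in> arr_to C (tgt C g)" using f g fg by (simp add: tgt_comp)
  obtain h' g' h'' f' where s: "sq h' g' g h" and t: "sq h'' f' f h'"
    using sq_obtain2[OF f g fg h] by blast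
  note D = fiber_squareD[OF s] fiber_squareD[OF t]
  note st = fiber_square_paste_vertical[OF s t]
  have "at ?e h'' (g' \<cdot> f') (g \<cdot> f) h m \<in> hom (gr F (src C h'') m) (gr F (src C h) (m + i + j))"
    using coop_at_prod[OF c s t] D
    by - (rule hom_gr_cong[OF _ hom_compose[OF coop_at_hom[OF c t] coop_at_hom[OF d s]]];
        auto simp: src_obj)
  with st show "\<exists>g' f'. sq g' f' (g \<cdot> f) h \<and>
      at ?e g' f' (g \<cdot> f) h m \<in> hom (gr F (src C g') m) (gr F (src C h) (m + (i + j)))"
    by (auto simp: add.assoc)
  fix k assume k: "k \<in> arr_to C (src C h)"
  obtain k' g'' k'' f'' where p: "sq k' g'' g' k" and q: "sq k'' f'' f' k'"
    by (rule sq_obtain2[of f' g' k]) (use k D in auto)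
  note pq = fiber_square_paste_vertical[OF p q]
  note sp = fiber_square_paste[OF s p] and tq = fiber_square_paste[OF t q]
  note E = fiber_squareD[OF p] fiber_squareD[OF q]
  have "at ?e (h'' \<cdot> k'') (g'' \<cdot> f'') (g \<cdot> f) (h \<cdot> k) m (fmap F k'' m x) =
      fmap F k (m + (i + j)) (at ?e h'' (g' \<cdot> f') (g \<cdot> f) h m x)" if x: "x \<in> el (src C h'') m" for x
  proof -
    have x': "fmap F k'' m x \<in> el (src C (h'' \<cdot> k'')) m"
      using x D E by (intro fmap_closed') (auto simp: src_comp)
    have y: "at c h'' f' f h' m x \<in> el (src C h') (m + i)" by (rule coop_at_in[OF c t x])
    \<comment> \<open>Compatibility of \<open>c\<close> turns restriction along \<open>k''\<close>
      into restriction along \<open>k'\<close>, and compatibility of \<open>d\<close> turns this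
      into restriction along \<open>k\<close>.\<close>
    show ?thesis
      unfolding coop_at_prod[OF c sp tq x'] coop_at_prod[OF c s t x] coop_at_fmap[OF c t q x]
        coop_at_fmap[OF d s p y]
      by (simp add: add.assoc)
  qed
  with st pq show "\<exists>g' f' h' f''. sq g' f' (g \<cdot> f) h \<and> sq h' f'' f' k \<and> (\<forall>x \<in> el (src C g') m.
      at ?e (g' \<cdot> h') f'' (g \<cdot> f) (h \<cdot> k) m (fmap F h' m x) =
      fmap F k (m + (i + j)) (at ?e g' f' (g \<cdot> f) h m x))"
    by blast
qed

lemma coop_push_in:
  assumes f: "f \<in> arr C" and g: "g \<in> arr C" and fg: "tgt C f = src C g"
    and c: "c \<in> coop_carrier C F (g \<cdot> f) i"
  shows "coop_push C F f g i c \<in> coop_carrier C F g i" (is "?e \<in> _")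
proof (rule coop_carrierI[OF g])
  show "?e = coop_family C F g (\<lambda>h m x.
       let h' = pr1 C g h; g' = pr2 C g h; h'' = pr1 C f h'; f' = pr2 C f h'
       in at c h'' (g' \<cdot> f') (g \<cdot> f) h m (fmap F f' m x))"
    by (rule coop_push_def)
  fix h m assume h: "h \<in> arr_to C (tgt C g)"
  obtain h' g' h'' f' where s: "sq h' g' g h" and t: "sq h'' f' f h'"
    using sq_obtain2[OF f g fg h] by blast
  note D = fiber_squareD[OF s] fiber_squareD[OF t]
  note st = fiber_square_paste_vertical[OF s t]
  have f': "fmap F f' m \<in> hom (gr F (src C h') m) (gr F (src C h'') m)"
    using fmap_hom[of f' m] D by simp
  have "at ?e h' g' g h m \<in> hom (gr F (src C h') m) (gr F (src C h) (m + i))"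
    using coop_at_push[OF s t] D
    by - (rule hom_gr_cong[OF _ hom_compose[OF f' coop_at_hom[OF c st]]]; auto simp: src_obj)
  with s show "\<exists>g' f'. sq g' f' g h \<and>
      at ?e g' f' g h m \<in> hom (gr F (src C g') m) (gr F (src C h) (m + i))"
    by blast
  fix k assume k: "k \<in> arr_to C (src C h)"
  obtain k' g'' k'' f'' where p: "sq k' g'' g' k" and q: "sq k'' f'' f' k'"
    by (rule sq_obtain2[of f' g' k]) (use k D in auto)
  note pq = fiber_square_paste_vertical[OF p q]
  note sp = fiber_square_paste[OF s p] and tq = fiber_square_paste[OF t q]
  note E = fiber_squareD[OF p] fiber_squareD[OF q]
  have "at ?e (h' \<cdot> k') g'' g (h \<cdot> k) m (fmap F k' m x) =
      fmap F k (m + i) (at ?e h' g' g h m x)" if x: "x \<in> el (src C h') m" for x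
  proof -
    have x': "fmap F k' m x \<in> el (src C (h' \<cdot> k')) m"
      using x D E by (intro fmap_closed') (auto simp: src_comp)
    have y: "fmap F f' m x \<in> el (src C h'') m"
      using x D by (intro fmap_closed') auto
    \<comment> \<open>The square \<open>q\<close> commutes, and \<open>F\<close> makes the two
      restrictions commute accordingly.\<close>
    have "fmap F f'' m (fmap F k' m x) = fmap F k'' m (fmap F f' m x)"
      using x D E fmap_comp[of f'' k' x m] fmap_comp[of k'' f' x m] by simp
    then show ?thesis
      unfolding coop_at_push[OF sp tq x'] coop_at_push[OF s t x] coop_at_fmap[OF c st pq y, symmetric]
      by simp
  qed
  with s p show "\<exists>g' f' h' f''. sq g' f' g h \<and> sq h' f'' f' k \<and> (\<forall>x \<in> el (src C g') m.
      at ?e (g' \<cdot> h') f'' g (h \<cdot> k) m (fmap F h' m x) = fmap F k (m + i) (at ?e g' f' g h m x))"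
    by blast
qed

text \<open>Pullback reindexes the family by composition with \<open>g\<close>, so compatibility for
  \<open>h\<close>, \<open>k\<close> is that of \<open>c\<close> for \<open>g \<cdot> h\<close>,
  \<open>k\<close>.\<close>

lemma coop_pull_in:
  assumes s: "sq g' f' f g" and c: "c \<in> coop_carrier C F f i"
  shows "coop_pull C F g' f' f g i c \<in> coop_carrier C F f' i" (is "?e \<in> _")
proof (rule coop_carrierI)
  note D = fiber_squareD[OF s]
  show f': "f' \<in> arr C" by fact
  show "?e = coop_family C F f' (\<lambda>h m x.
       let h' = pr1 C f' h; f'' = pr2 C f' h in at c (g' \<cdot> h') f'' f (g \<cdot> h) m x)"
    by (rule coop_pull_def)
  fix h m assume h: "h \<in> arr_to C (tgt C f')"
  obtain h' f'' where t: "sq h' f'' f' h" using sq_obtain[OF f' h] by blast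
  note E = fiber_squareD[OF t]
  note st = fiber_square_paste[OF s t]
  have "at c (g' \<cdot> h') f'' f (g \<cdot> h) m \<in> hom (gr F (src C h') m) (gr F (src C h) (m + i))"
    using coop_at_hom[OF c st, of m] D E by (simp add: src_comp)
  then have "at ?e h' f'' f' h m \<in> hom (gr F (src C h') m) (gr F (src C h) (m + i))"
    using coop_at_pull[OF s t] E by - (rule hom_gr_cong; auto simp: src_obj)
  with t show "\<exists>g' f''. sq g' f'' f' h \<and>
      at ?e g' f'' f' h m \<in> hom (gr F (src C g') m) (gr F (src C h) (m + i))"
    by blast
  fix k assume k: "k \<in> arr_to C (src C h)"
  obtain k' f3 where p: "sq k' f3 f'' k" using sq_obtain[of f'' k] k E by auto
  note P = fiber_squareD[OF p]
  have "at ?e (h' \<cdot> k') f3 f' (h \<cdot> k) m (fmap F k' m x) =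
      fmap F k (m + i) (at ?e h' f'' f' h m x)" if x: "x \<in> el (src C h') m" for x
  proof -
    have x': "fmap F k' m x \<in> el (src C (h' \<cdot> k')) m"
      using x E P by (intro fmap_closed') (auto simp: src_comp)
    have x'': "x \<in> el (src C (g' \<cdot> h')) m" using x D E by (simp add: src_comp)
    show ?thesis
      unfolding coop_at_pull[OF s fiber_square_paste[OF t p] x'] coop_at_pull[OF s t x]
        coop_at_fmap[OF c st p x'', symmetric]
      using D E P by (simp add: comp_assoc)
  qed
  with t p show "\<exists>g' f'' h' f3. sq g' f'' f' h \<and> sq h' f3 f'' k \<and> (\<forall>x \<in> el (src C g') m.
      at ?e (g' \<cdot> h') f3 f' (h \<cdot> k) m (fmap F h' m x) = fmap F k (m + i) (at ?e g' f'' f' h m x))"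
    by blast
qed

section \<open>Additivity of the operations\<close>

lemma coop_prod_hom_right:
  assumes f: "f \<in> arr C" and g: "g \<in> arr C" and fg: "tgt C f = src C g"
    and c: "c \<in> coop_carrier C F f i"
  shows "(\<lambda>d. coop_prod C F f g i j c d) \<in> hom (coop_group C F g j) (coop_group C F (g \<cdot> f) (i + j))"
proof (rule homI; unfold carrier_coop_group)
  fix d d' assume d: "d \<in> coop_carrier C F g j" and d': "d' \<in> coop_carrier C F g j"
  note in_prod = coop_prod_in[OF f g fg c]
  show "coop_prod C F f g i j c d \<in> coop_carrier C F (g \<cdot> f) (i + j)" by (rule in_prod[OF d])
  have gf: "g \<cdot> f \<in> arr C" "tgt C (g \<cdot> f) = tgt C g" using f g fg by (auto simp: comp_arr tgt_comp)
  show "coop_prod C F f g i j c (d \<otimes>\<^bsub>coop_group C F g j\<^esub> d') =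
      coop_prod C F f g i j c d \<otimes>\<^bsub>coop_group C F (g \<cdot> f) (i + j)\<^esub> coop_prod C F f g i j c d'"
  proof (rule coop_eqI)
    fix h assume h: "h \<in> arr_to C (tgt C (g \<cdot> f))"
    then obtain h' g' h'' f' where s: "sq h' g' g h" and t: "sq h'' f' f h'"
      using sq_obtain2[OF f g fg] gf by metis
    note st = fiber_square_paste_vertical[OF s t]
    show "\<exists>a b. sq a b (g \<cdot> f) h \<and> (\<forall>m. \<forall>x \<in> el (src C a) m.
        at (coop_prod C F f g i j c (d \<otimes>\<^bsub>coop_group C F g j\<^esub> d')) a b (g \<cdot> f) h m x =
        at (coop_prod C F f g i j c d \<otimes>\<^bsub>coop_group C F (g \<cdot> f) (i + j)\<^esub> coop_prod C F f g i j c d')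
          a b (g \<cdot> f) h m x)"
      using st coop_at_in[OF c t]
      by (intro exI[of _ h''] exI[of _ "g' \<cdot> f'"])
        (simp add: coop_at_mult coop_at_prod[OF c s t] coop_at_mult[OF s] add.assoc)
  qed (use in_prod d d' g gf in \<open>auto intro!: coop_mult_in\<close>)
qed

text \<open>Addition in the second factor is pointwise on the outer map; here the sum is formed
  inside, and the outer map given by \<open>d\<close> has to be a homomorphism to let it
  out.\<close>

lemma coop_prod_hom_left:
  assumes f: "f \<in> arr C" and g: "g \<in> arr C" and fg: "tgt C f = src C g"
    and d: "d \<in> coop_carrier C F g j"
  shows "(\<lambda>c. coop_prod C F f g i j c d) \<in> hom (coop_group C F f i) (coop_group C F (g \<cdot> f) (i + j))"
proof (rule homI; unfold carrier_coop_group)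
  fix c c' assume c: "c \<in> coop_carrier C F f i" and c': "c' \<in> coop_carrier C F f i"
  note in_prod = coop_prod_in[OF f g fg _ d]
  note cc = coop_mult_in[OF f c c']
  show "coop_prod C F f g i j c d \<in> coop_carrier C F (g \<cdot> f) (i + j)" by (rule in_prod[OF c])
  have gf: "g \<cdot> f \<in> arr C" "tgt C (g \<cdot> f) = tgt C g" using f g fg by (auto simp: comp_arr tgt_comp)
  show "coop_prod C F f g i j (c \<otimes>\<^bsub>coop_group C F f i\<^esub> c') d =
      coop_prod C F f g i j c d \<otimes>\<^bsub>coop_group C F (g \<cdot> f) (i + j)\<^esub> coop_prod C F f g i j c' d"
  proof (rule coop_eqI)
    fix h assume h: "h \<in> arr_to C (tgt C (g \<cdot> f))"
    then obtain h' g' h'' f' where s: "sq h' g' g h" and t: "sq h'' f' f h'"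
      using sq_obtain2[OF f g fg] gf by metis
    note st = fiber_square_paste_vertical[OF s t]
    show "\<exists>a b. sq a b (g \<cdot> f) h \<and> (\<forall>m. \<forall>x \<in> el (src C a) m.
        at (coop_prod C F f g i j (c \<otimes>\<^bsub>coop_group C F f i\<^esub> c') d) a b (g \<cdot> f) h m x =
        at (coop_prod C F f g i j c d \<otimes>\<^bsub>coop_group C F (g \<cdot> f) (i + j)\<^esub> coop_prod C F f g i j c' d)
          a b (g \<cdot> f) h m x)"
      using st coop_at_in[OF c t] coop_at_in[OF c' t] hom_mult[OF coop_at_hom[OF d s]]
      by (intro exI[of _ h''] exI[of _ "g' \<cdot> f'"])
        (simp add: coop_at_mult coop_at_prod[OF cc s t] coop_at_prod[OF c s t] coop_at_prod[OF c' s t]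
          coop_at_mult[OF t] add.assoc)
  qed (use in_prod c c' cc gf in \<open>auto intro!: coop_mult_in\<close>)
qed

lemma coop_push_hom:
  assumes f: "f \<in> arr C" and g: "g \<in> arr C" and fg: "tgt C f = src C g"
  shows "coop_push C F f g i \<in> hom (coop_group C F (g \<cdot> f) i) (coop_group C F g i)"
proof (rule homI; unfold carrier_coop_group)
  fix c c' assume c: "c \<in> coop_carrier C F (g \<cdot> f) i" and c': "c' \<in> coop_carrier C F (g \<cdot> f) i"
  note in_push = coop_push_in[OF f g fg]
  show "coop_push C F f g i c \<in> coop_carrier C F g i" by (rule in_push[OF c])
  have gf: "g \<cdot> f \<in> arr C" using f g fg by (auto simp: comp_arr)
  show "coop_push C F f g i (c \<otimes>\<^bsub>coop_group C F (g \<cdot> f) i\<^esub> c') =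
      coop_push C F f g i c \<otimes>\<^bsub>coop_group C F g i\<^esub> coop_push C F f g i c'"
  proof (rule coop_eqI)
    fix h assume h: "h \<in> arr_to C (tgt C g)"
    then obtain h' g' h'' f' where s: "sq h' g' g h" and t: "sq h'' f' f h'"
      using sq_obtain2[OF f g fg] by metis
    note st = fiber_square_paste_vertical[OF s t]
    show "\<exists>a b. sq a b g h \<and> (\<forall>m. \<forall>x \<in> el (src C a) m.
        at (coop_push C F f g i (c \<otimes>\<^bsub>coop_group C F (g \<cdot> f) i\<^esub> c')) a b g h m x =
        at (coop_push C F f g i c \<otimes>\<^bsub>coop_group C F g i\<^esub> coop_push C F f g i c') a b g h m x)"
      using s fmap_closed[of f'] fiber_squareD[OF t]
      by (intro exI[of _ h'] exI[of _ g'])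
        (simp add: coop_at_mult[OF s] coop_at_push[OF s t] coop_at_mult[OF st])
  qed (use in_push c c' g gf in \<open>auto intro!: coop_mult_in\<close>)
qed

lemma coop_pull_hom:
  assumes s: "sq g' f' f g"
  shows "coop_pull C F g' f' f g i \<in> hom (coop_group C F f i) (coop_group C F f' i)"
proof (rule homI; unfold carrier_coop_group)
  fix c c' assume c: "c \<in> coop_carrier C F f i" and c': "c' \<in> coop_carrier C F f i"
  note D = fiber_squareD[OF s]
  note in_pull = coop_pull_in[OF s]
  show "coop_pull C F g' f' f g i c \<in> coop_carrier C F f' i" by (rule in_pull[OF c])
  show "coop_pull C F g' f' f g i (c \<otimes>\<^bsub>coop_group C F f i\<^esub> c') =
      coop_pull C F g' f' f g i c \<otimes>\<^bsub>coop_group C F f' i\<^esub> coop_pull C F g' f' f g i c'"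
  proof (rule coop_eqI)
    fix h assume h: "h \<in> arr_to C (tgt C f')"
    then obtain h' f'' where t: "sq h' f'' f' h" using sq_obtain[OF D(2)] by metis
    note st = fiber_square_paste[OF s t]
    show "\<exists>a b. sq a b f' h \<and> (\<forall>m. \<forall>x \<in> el (src C a) m.
        at (coop_pull C F g' f' f g i (c \<otimes>\<^bsub>coop_group C F f i\<^esub> c')) a b f' h m x =
        at (coop_pull C F g' f' f g i c \<otimes>\<^bsub>coop_group C F f' i\<^esub> coop_pull C F g' f' f g i c') a b f' h m x)"
      using t D fiber_squareD[OF t]
      by (intro exI[of _ h'] exI[of _ f''])
        (simp add: coop_at_mult[OF t] coop_at_pull[OF s t] coop_at_mult[OF st] src_comp)
  qed (use in_pull c c' D in \<open>auto intro!: coop_mult_in\<close>)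
qed

section \<open>The axioms\<close>

lemma sq_obtain3:
  assumes f: "f \<in> arr C" and g: "g \<in> arr C" and h: "h \<in> arr C"
    and fg: "tgt C f = src C g" and gh: "tgt C g = src C h" and k: "k \<in> arr_to C (tgt C h)"
  obtains k1 h' k2 g' k3 f' where "sq k1 h' h k" "sq k2 g' g k1" "sq k3 f' f k2"
proof -
  obtain k1 h' k2 g' where s: "sq k1 h' h k" "sq k2 g' g k1"
    using sq_obtain2[OF g h gh k] by blast
  note D = fiber_squareD[OF s(1)] fiber_squareD[OF s(2)]
  obtain k3 f' where "sq k3 f' f k2"
    by (rule sq_obtain[of f k2]) (use f fg D in \<open>auto simp: arr_to_def\<close>)
  with s show thesis using that by blast
qed

lemma coop_A1:
  assumes f: "f \<in> arr C" and g: "g \<in> arr C" and h: "h \<in> arr C"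
    and fg: "tgt C f = src C g" and gh: "tgt C g = src C h"
    and a: "\<alpha> \<in> coop_carrier C F f i" and b: "\<beta> \<in> coop_carrier C F g j"
    and c: "\<gamma> \<in> coop_carrier C F h k"
  shows "coop_prod C F (g \<cdot> f) h (i + j) k (coop_prod C F f g i j \<alpha> \<beta>) \<gamma> =
    coop_prod C F f (h \<cdot> g) i (j + k) \<alpha> (coop_prod C F g h j k \<beta> \<gamma>)" (is "?l = ?r")
proof (rule coop_eqI)
  have gf: "g \<cdot> f \<in> arr C" "tgt C (g \<cdot> f) = src C h" and hg: "h \<cdot> g \<in> arr C" "tgt C f = src C (h \<cdot> g)"
    and hgf: "tgt C (h \<cdot> (g \<cdot> f)) = tgt C h" "(h \<cdot> g) \<cdot> f = h \<cdot> (g \<cdot> f)"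
    using f g h fg gh by (auto simp: comp_arr src_comp tgt_comp comp_assoc)
  note ab = coop_prod_in[OF f g fg a b] and bc = coop_prod_in[OF g h gh b c]
  show "?l \<in> coop_carrier C F (h \<cdot> (g \<cdot> f)) (i + j + k)"
    by (rule coop_prod_in[OF gf(1) h gf(2) ab c])
  show "?r \<in> coop_carrier C F (h \<cdot> (g \<cdot> f)) (i + j + k)"
    using coop_prod_in[OF f hg a bc] hgf(2) by (simp add: add.assoc)
  fix l assume "l \<in> arr_to C (tgt C (h \<cdot> (g \<cdot> f)))"
  then have l: "l \<in> arr_to C (tgt C h)" using hgf by simp
  obtain k1 h' k2 g' k3 f' where s: "sq k1 h' h l" "sq k2 g' g k1" "sq k3 f' f k2"
    using sq_obtain3[OF f g h fg gh l] by blast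
  note D = fiber_squareD[OF s(1)] fiber_squareD[OF s(2)] fiber_squareD[OF s(3)]
  note s12 = fiber_square_paste_vertical[OF s(1,2)] and s23 = fiber_square_paste_vertical[OF s(2,3)]
  note s123 = fiber_square_paste_vertical[OF s(1) s23]
  \<comment> \<open>The two sides bracket the stack of three squares differently; \<open>e\<close>
    identifies the resulting left edges.\<close>
  have e: "(h' \<cdot> g') \<cdot> f' = h' \<cdot> (g' \<cdot> f')" using D by (simp add: comp_assoc)
  have "at ?l k3 (h' \<cdot> (g' \<cdot> f')) (h \<cdot> (g \<cdot> f)) l m x = at ?r k3 (h' \<cdot> (g' \<cdot> f')) (h \<cdot> (g \<cdot> f)) l m x"
    if x: "x \<in> el (src C k3) m" for m x
    using coop_at_prod[OF ab s(1) s23 x, of k \<gamma>] coop_at_prod[OF a s(2,3) x, of j \<beta>]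
      coop_at_prod[OF a s12 s(3) x, of "j + k" "coop_prod C F g h j k \<beta> \<gamma>", unfolded e hgf(2)]
      coop_at_prod[OF b s(1,2) coop_at_in[OF a s(3) x], of k \<gamma>]
    by (simp add: add.assoc)
  with s123 show "\<exists>g' f'. sq g' f' (h \<cdot> (g \<cdot> f)) l \<and> (\<forall>m. \<forall>x \<in> el (src C g') m.
      at ?l g' f' (h \<cdot> (g \<cdot> f)) l m x = at ?r g' f' (h \<cdot> (g \<cdot> f)) l m x)"
    by blast
qed

text \<open>Pushforward is precomposition with a restriction, so the axiom is contravariant
  functoriality of \<open>F\<close> on the base change of the chain \<open>f\<close>,
  \<open>g\<close>.\<close>

lemma coop_A2:
  assumes f: "f \<in> arr C" and g: "g \<in> arr C" and h: "h \<in> arr C"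
    and fg: "tgt C f = src C g" and gh: "tgt C g = src C h"
    and a: "\<alpha> \<in> coop_carrier C F (h \<cdot> (g \<cdot> f)) i"
  shows "coop_push C F (g \<cdot> f) h i \<alpha> = coop_push C F g h i (coop_push C F f (h \<cdot> g) i \<alpha>)" (is "?l = ?r")
proof (rule coop_eqI)
  have gf: "g \<cdot> f \<in> arr C" "tgt C (g \<cdot> f) = src C h" and hg: "h \<cdot> g \<in> arr C" "tgt C f = src C (h \<cdot> g)"
    and hgf: "(h \<cdot> g) \<cdot> f = h \<cdot> (g \<cdot> f)"
    using f g h fg gh by (auto simp: comp_arr src_comp tgt_comp comp_assoc)
  show "?l \<in> coop_carrier C F h i" by (rule coop_push_in[OF gf(1) h gf(2) a])
  show "?r \<in> coop_carrier C F h i"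
    by (intro coop_push_in f g h hg fg gh) (use a hgf in simp)
  fix l assume l: "l \<in> arr_to C (tgt C h)"
  obtain k1 h' k2 g' k3 f' where s: "sq k1 h' h l" "sq k2 g' g k1" "sq k3 f' f k2"
    using sq_obtain3[OF f g h fg gh l] by blast
  note D = fiber_squareD[OF s(1)] fiber_squareD[OF s(2)] fiber_squareD[OF s(3)]
  note s12 = fiber_square_paste_vertical[OF s(1,2)] and s23 = fiber_square_paste_vertical[OF s(2,3)]
  have e: "(h' \<cdot> g') \<cdot> f' = h' \<cdot> (g' \<cdot> f')" using D by (simp add: comp_assoc)
  have "at ?l k1 h' h l m x = at ?r k1 h' h l m x" if x: "x \<in> el (src C k1) m" for m x
  proof -
    have x': "fmap F g' m x \<in> el (src C k2) m" using x D by (intro fmap_closed') auto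
    have "fmap F (g' \<cdot> f') m x = fmap F f' m (fmap F g' m x)"
      using x D by (intro fmap_comp) auto
    then show ?thesis
      using coop_at_push[OF s(1) s23 x, of i \<alpha>] coop_at_push[OF s(1,2) x, of i "coop_push C F f (h \<cdot> g) i \<alpha>"]
        coop_at_push[OF s12 s(3) x', of i \<alpha>] by (simp add: e hgf)
  qed
  with s(1) show "\<exists>g' f'. sq g' f' h l \<and> (\<forall>m. \<forall>x \<in> el (src C g') m. at ?l g' f' h l m x = at ?r g' f' h l m x)"
    by blast
qed

text \<open>Both sides reindex \<alpha> along the same composite, bracketed as
  \<open>(g \<cdot> h) \<cdot> k\<close> and as \<open>g \<cdot> (h \<cdot> k)\<close>.\<close>

lemma coop_A3:
  assumes s: "sq g' f' f g" and t: "sq h' f'' f' h" and a: "\<alpha> \<in> coop_carrier C F f i"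
  shows "coop_pull C F (g' \<cdot> h') f'' f (g \<cdot> h) i \<alpha> = coop_pull C F h' f'' f' h i (coop_pull C F g' f' f g i \<alpha>)"
    (is "?l = ?r")
proof (rule coop_eqI)
  note st = fiber_square_paste[OF s t]
  note D = fiber_squareD[OF s] fiber_squareD[OF t]
  show "?l \<in> coop_carrier C F f'' i" by (rule coop_pull_in[OF st a])
  show "?r \<in> coop_carrier C F f'' i" by (rule coop_pull_in[OF t coop_pull_in[OF s a]])
  fix k assume k: "k \<in> arr_to C (tgt C f'')"
  obtain k' f3 where u: "sq k' f3 f'' k" using sq_obtain[OF D(11) k] by blast
  note E = fiber_squareD[OF u]
  have "at ?l k' f3 f'' k m x = at ?r k' f3 f'' k m x" if x: "x \<in> el (src C k') m" for m x
  proof -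
    have "x \<in> el (src C (h' \<cdot> k')) m" using x D E by (simp add: src_comp)
    then show ?thesis
      using coop_at_pull[OF st u x, of i \<alpha>] coop_at_pull[OF t u x, of i "coop_pull C F g' f' f g i \<alpha>"]
        coop_at_pull[OF s fiber_square_paste[OF t u], of x m i \<alpha>] D E
      by (simp add: comp_assoc)
  qed
  with u show "\<exists>g' f'. sq g' f' f'' k \<and> (\<forall>m. \<forall>x \<in> el (src C g') m. at ?l g' f' f'' k m x = at ?r g' f' f'' k m x)"
    by blast
qed

text \<open>Pushforward acts before \<alpha> and multiplication by \<beta> after it, so both sides
  are one threefold composite: restriction along \<open>f'\<close>, then \<alpha>, then
  \<beta>.\<close>

lemma coop_A12:
  assumes f: "f \<in> arr C" and g: "g \<in> arr C" and h: "h \<in> arr C"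
    and fg: "tgt C f = src C g" and gh: "tgt C g = src C h"
    and a: "\<alpha> \<in> coop_carrier C F (g \<cdot> f) i" and b: "\<beta> \<in> coop_carrier C F h j"
  shows "coop_push C F f (h \<cdot> g) (i + j) (coop_prod C F (g \<cdot> f) h i j \<alpha> \<beta>) =
    coop_prod C F g h i j (coop_push C F f g i \<alpha>) \<beta>" (is "?l = ?r")
proof (rule coop_eqI)
  have gf: "g \<cdot> f \<in> arr C" "tgt C (g \<cdot> f) = src C h" and hg: "h \<cdot> g \<in> arr C" "tgt C f = src C (h \<cdot> g)"
    and hgf: "tgt C (h \<cdot> g) = tgt C h" "(h \<cdot> g) \<cdot> f = h \<cdot> (g \<cdot> f)"
    using f g h fg gh by (auto simp: comp_arr src_comp tgt_comp comp_assoc)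
  note ab = coop_prod_in[OF gf(1) h gf(2) a b] and fa = coop_push_in[OF f g fg a]
  show "?l \<in> coop_carrier C F (h \<cdot> g) (i + j)"
    by (rule coop_push_in[OF f hg]) (use ab hgf in simp)
  show "?r \<in> coop_carrier C F (h \<cdot> g) (i + j)" by (rule coop_prod_in[OF g h gh fa b])
  fix l assume "l \<in> arr_to C (tgt C (h \<cdot> g))"
  then have l: "l \<in> arr_to C (tgt C h)" using hgf by simp
  obtain k1 h' k2 g' k3 f' where s: "sq k1 h' h l" "sq k2 g' g k1" "sq k3 f' f k2"
    using sq_obtain3[OF f g h fg gh l] by blast
  note D = fiber_squareD[OF s(1)] fiber_squareD[OF s(2)] fiber_squareD[OF s(3)]
  note s12 = fiber_square_paste_vertical[OF s(1,2)] and s23 = fiber_square_paste_vertical[OF s(2,3)]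
  have e: "(h' \<cdot> g') \<cdot> f' = h' \<cdot> (g' \<cdot> f')" using D by (simp add: comp_assoc)
  have "at ?l k2 (h' \<cdot> g') (h \<cdot> g) l m x = at ?r k2 (h' \<cdot> g') (h \<cdot> g) l m x"
    if x: "x \<in> el (src C k2) m" for m x
  proof -
    have x': "fmap F f' m x \<in> el (src C k3) m" using x D by (intro fmap_closed') auto
    show ?thesis
      using coop_at_push[OF s12 s(3) x, of "i + j" "coop_prod C F (g \<cdot> f) h i j \<alpha> \<beta>"]
        coop_at_prod[OF a s(1) s23 x', of j \<beta>] coop_at_prod[OF fa s(1,2) x, of j \<beta>]
        coop_at_push[OF s(2,3) x, of i \<alpha>] by (simp add: e hgf)
  qed
  with s12 show "\<exists>g' f'. sq g' f' (h \<cdot> g) l \<and> (\<forall>m. \<forall>x \<in> el (src C g') m.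
      at ?l g' f' (h \<cdot> g) l m x = at ?r g' f' (h \<cdot> g) l m x)"
    by blast
qed

text \<open>Over \<open>k\<close> both sides apply \<alpha> over \<open>h' \<cdot> k1\<close> and
  then \<beta> over \<open>h \<cdot> k\<close>. By pasting, \<open>h' \<cdot> k1\<close> is the
  projection belonging to \<open>g\<close> and \<open>h \<cdot> k\<close>, as the product formula
  requires.\<close>

lemma coop_A13:
  assumes s: "sq h' g' g h" and t: "sq h'' f' f h'"
    and a: "\<alpha> \<in> coop_carrier C F f i" and b: "\<beta> \<in> coop_carrier C F g j"
  shows "coop_pull C F h'' (g' \<cdot> f') (g \<cdot> f) h (i + j) (coop_prod C F f g i j \<alpha> \<beta>) =
    coop_prod C F f' g' i j (coop_pull C F h'' f' f h' i \<alpha>) (coop_pull C F h' g' g h j \<beta>)" (is "?l = ?r")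
proof (rule coop_eqI)
  note D = fiber_squareD[OF s] fiber_squareD[OF t]
  note st = fiber_square_paste_vertical[OF s t]
  note pa = coop_pull_in[OF t a] and pb = coop_pull_in[OF s b]
  have gf: "tgt C (g' \<cdot> f') = tgt C g'" "tgt C f' = src C g'" "tgt C f = src C g" using D by (auto simp: tgt_comp)
  show "?l \<in> coop_carrier C F (g' \<cdot> f') (i + j)"
    by (rule coop_pull_in[OF st coop_prod_in[OF _ _ _ a b]]) (use D gf in auto)
  show "?r \<in> coop_carrier C F (g' \<cdot> f') (i + j)"
    by (rule coop_prod_in[OF _ _ _ pa pb]) (use D gf in auto)
  fix k assume "k \<in> arr_to C (tgt C (g' \<cdot> f'))"
  then obtain k1 g2 k2 f2 where p: "sq k1 g2 g' k" and q: "sq k2 f2 f' k1"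
    using sq_obtain2[OF D(11,2) gf(2), of k] gf(1) by metis
  note pq = fiber_square_paste_vertical[OF p q]
  note sp = fiber_square_paste[OF s p] and tq = fiber_square_paste[OF t q]
  note E = fiber_squareD[OF p] fiber_squareD[OF q]
  have "at ?l k2 (g2 \<cdot> f2) (g' \<cdot> f') k m x = at ?r k2 (g2 \<cdot> f2) (g' \<cdot> f') k m x"
    if x: "x \<in> el (src C k2) m" for m x
  proof -
    have x': "x \<in> el (src C (h'' \<cdot> k2)) m" using x D E by (simp add: src_comp)
    show ?thesis
      using coop_at_pull[OF st pq x, of "i + j" "coop_prod C F f g i j \<alpha> \<beta>"]
        coop_at_prod[OF a sp tq x', of j \<beta>] coop_at_prod[OF pa p q x, of j "coop_pull C F h' g' g h j \<beta>"]
        coop_at_pull[OF t q x, of i \<alpha>] coop_at_pull[OF s p coop_at_in[OF pa q x], of j \<beta>]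
      by simp
  qed
  with pq show "\<exists>a b. sq a b (g' \<cdot> f') k \<and> (\<forall>m. \<forall>x \<in> el (src C a) m.
      at ?l a b (g' \<cdot> f') k m x = at ?r a b (g' \<cdot> f') k m x)"
    by blast
qed

text \<open>Over \<open>k\<close> both sides restrict along \<open>f2\<close> and then evaluate
  \<alpha> over \<open>h \<cdot> k\<close>. The pasting \<open>tq\<close> shows that
  \<open>f2\<close> is also the base change of \<open>f\<close> along
  \<open>h' \<cdot> k1\<close>.\<close>

lemma coop_A23:
  assumes s: "sq h' g' g h" and t: "sq h'' f' f h'" and a: "\<alpha> \<in> coop_carrier C F (g \<cdot> f) i"
  shows "coop_push C F f' g' i (coop_pull C F h'' (g' \<cdot> f') (g \<cdot> f) h i \<alpha>) =
    coop_pull C F h' g' g h i (coop_push C F f g i \<alpha>)" (is "?l = ?r")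
proof (rule coop_eqI)
  note D = fiber_squareD[OF s] fiber_squareD[OF t]
  note st = fiber_square_paste_vertical[OF s t]
  have gf: "tgt C f' = src C g'" "tgt C f = src C g" using D by auto
  show "?l \<in> coop_carrier C F g' i"
    by (rule coop_push_in[OF _ _ _ coop_pull_in[OF st a]]) (use D gf in auto)
  show "?r \<in> coop_carrier C F g' i"
    by (rule coop_pull_in[OF s coop_push_in[OF _ _ _ a]]) (use D gf in auto)
  fix k assume "k \<in> arr_to C (tgt C g')"
  then obtain k1 g2 k2 f2 where p: "sq k1 g2 g' k" and q: "sq k2 f2 f' k1"
    using sq_obtain2[OF D(11,2) gf(1), of k] by metis
  note pq = fiber_square_paste_vertical[OF p q]
  note sp = fiber_square_paste[OF s p] and tq = fiber_square_paste[OF t q]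
  note E = fiber_squareD[OF p] fiber_squareD[OF q]
  have "at ?l k1 g2 g' k m x = at ?r k1 g2 g' k m x" if x: "x \<in> el (src C k1) m" for m x
  proof -
    have x': "x \<in> el (src C (h' \<cdot> k1)) m" using x D E by (simp add: src_comp)
    have x'': "fmap F f2 m x \<in> el (src C k2) m" using x E by (intro fmap_closed') auto
    show ?thesis
      using coop_at_push[OF p q x, of i "coop_pull C F h'' (g' \<cdot> f') (g \<cdot> f) h i \<alpha>"]
        coop_at_pull[OF st pq x'', of i \<alpha>] coop_at_pull[OF s p x, of i "coop_push C F f g i \<alpha>"]
        coop_at_push[OF sp tq x', of i \<alpha>]
      by simp
  qed
  with p show "\<exists>a b. sq a b g' k \<and> (\<forall>m. \<forall>x \<in> el (src C a) m. at ?l a b g' k m x = at ?r a b g' k m x)"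
    by blast
qed

text \<open>
  Over \<open>k : Z' \<rightarrow> Z\<close> the square of \<open>f\<close> and \<open>g\<close> becomes the front face of a cube of fiber squares;
  compatibility of \<open>\<alpha>\<close> with pullback along the base change \<open>g1\<close> of \<open>g\<close> is what is needed there.
\<close>

lemma coop_A123:
  assumes s: "sq g' f' f g" and h: "h \<in> arr C" and gh: "tgt C g = src C h"
    and a: "\<alpha> \<in> coop_carrier C F f i" and b: "\<beta> \<in> coop_carrier C F (h \<cdot> g) j"
  shows "coop_push C F g' (h \<cdot> f) (i + j) (coop_prod C F f' (h \<cdot> g) i j (coop_pull C F g' f' f g i \<alpha>) \<beta>) =
    coop_prod C F f h i j \<alpha> (coop_push C F g h j \<beta>)" (is "?l = ?r")
proof (rule coop_eqI)
  note D = fiber_squareD[OF s]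
  note pa = coop_pull_in[OF s a]
  have hf: "h \<cdot> f \<in> arr C" "tgt C g' = src C (h \<cdot> f)" "tgt C f = src C h" "tgt C (h \<cdot> f) = tgt C h"
    and hg: "h \<cdot> g \<in> arr C" "tgt C f' = src C (h \<cdot> g)"
    and hfg: "(h \<cdot> f) \<cdot> g' = (h \<cdot> g) \<cdot> f'"
    using D h gh by (auto simp: comp_arr src_comp tgt_comp comp_assoc)
  note pab = coop_prod_in[OF D(2) hg pa b] and gb = coop_push_in[OF D(4) h gh b]
  show "?l \<in> coop_carrier C F (h \<cdot> f) (i + j)"
    by (rule coop_push_in[OF D(1) hf(1,2)]) (use pab hfg in simp)
  show "?r \<in> coop_carrier C F (h \<cdot> f) (i + j)" by (rule coop_prod_in[OF D(3) h hf(3) a gb])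
  fix k assume "k \<in> arr_to C (tgt C (h \<cdot> f))"
  then have k: "k \<in> arr_to C (tgt C h)" using hf by simp
  obtain k1 h' k2 g1 where p: "sq k1 h' h k" and q: "sq k2 g1 g k1"
    using sq_obtain2[OF D(4) h gh k] by blast
  note P = fiber_squareD[OF p] and Q = fiber_squareD[OF q]
  obtain k3 f1 where r: "sq k3 f1 f k1"
    by (rule sq_obtain[of f k1]) (use D P gh in \<open>auto simp: arr_to_def\<close>)
  obtain k4 f2 where t: "sq k4 f2 f' k2"
    by (rule sq_obtain[of f' k2]) (use D Q in \<open>auto simp: arr_to_def\<close>)
  note R = fiber_squareD[OF r] and T = fiber_squareD[OF t]
  note kf = fiber_square_paste[OF s t]
  have gk: "g \<cdot> k2 = k1 \<cdot> g1" by (rule Q(9))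
  have "f \<cdot> (g' \<cdot> k4) = (g \<cdot> k2) \<cdot> f2" by (rule fiber_squareD(9)[OF kf])
  also have "\<dots> = k1 \<cdot> (g1 \<cdot> f2)" unfolding gk using Q T by (intro comp_assoc) auto
  finally have eq: "f \<cdot> (g' \<cdot> k4) = k1 \<cdot> (g1 \<cdot> f2)" .
  \<comment> \<open>The missing edge of the cube; it will be the base change both of
    \<open>g'\<close> along \<open>k3\<close> and of \<open>g1\<close> along
    \<open>f1\<close>.\<close>
  define g2 where "g2 = mediating C k3 f1 (g' \<cdot> k4) (g1 \<cdot> f2)"
  have g2: "g2 \<in> arr C" "src C g2 = src C k4" "tgt C g2 = src C k3" "k3 \<cdot> g2 = g' \<cdot> k4" "f1 \<cdot> g2 = g1 \<cdot> f2"
    unfolding g2_def using fiber_square_mediating[OF r, of "g' \<cdot> k4" "g1 \<cdot> f2"] eq D Q R T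
    by (auto simp: comp_arr src_comp tgt_comp)
  \<comment> \<open>The rectangle \<open>kf\<close> lies over
    \<open>g \<cdot> k2 = k1 \<cdot> g1\<close>, and cancelling \<open>r\<close> from it leaves this
    face.\<close>
  have f1: "sq g2 f2 f1 g1"
    by (rule fiber_square_cancel[OF r]) (use kf g2 gk Q R in auto)
  \<comment> \<open>Seen from the other side, the cube gives a rectangle over
    \<open>k1 \<cdot> f1 = f \<cdot> k3\<close>, from which the flipped \<open>s\<close> can be
    cancelled.\<close>
  have "sq (k2 \<cdot> f2) g2 g (k1 \<cdot> f1)"
    by (rule fiber_square_paste[OF q fiber_square_flip[OF f1]])
  then have "sq (f' \<cdot> k4) g2 g (f \<cdot> k3)" using R(9) T(9) by simp
  then have top: "sq k4 g2 g' k3"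
    by (rule fiber_square_cancel[OF fiber_square_flip[OF s]]) (use g2 D R T in auto)
  note pr = fiber_square_paste_vertical[OF p r] and pq = fiber_square_paste_vertical[OF p q]
  have e: "(h' \<cdot> f1) \<cdot> g2 = (h' \<cdot> g1) \<cdot> f2" using g2 P Q R T by (simp add: comp_assoc)
  have "at ?l k3 (h' \<cdot> f1) (h \<cdot> f) k m x = at ?r k3 (h' \<cdot> f1) (h \<cdot> f) k m x"
    if x: "x \<in> el (src C k3) m" for m x
  proof -
    have x': "fmap F g2 m x \<in> el (src C k4) m" using x g2 by (intro fmap_closed') auto
    \<comment> \<open>The pulled-back \<alpha> over \<open>k2\<close> is \<alpha> over
      \<open>g \<cdot> k2 = k1 \<cdot> g1\<close>. Restricting along \<open>g2\<close> before it
      therefore amounts to restricting along \<open>g1\<close> after \<alpha> over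
      \<open>k1\<close>, the order found on the right-hand side.\<close>
    have "at (coop_pull C F g' f' f g i \<alpha>) k4 f2 f' k2 m (fmap F g2 m x) =
        fmap F g1 (m + i) (at \<alpha> k3 f1 f k1 m x)"
      using coop_at_pull[OF s t x', of i \<alpha>] coop_at_fmap[OF a r f1 x] by (simp add: g2 gk)
    then show ?thesis
      using coop_at_push[OF pr top x, of "i + j" "coop_prod C F f' (h \<cdot> g) i j (coop_pull C F g' f' f g i \<alpha>) \<beta>"]
        coop_at_prod[OF pa pq t x', of j \<beta>] coop_at_prod[OF a p r x, of j "coop_push C F g h j \<beta>"]
        coop_at_push[OF p q coop_at_in[OF a r x], of j \<beta>]
      by (simp add: e hfg)
  qed
  with pr show "\<exists>a b. sq a b (h \<cdot> f) k \<and> (\<forall>m. \<forall>x \<in> el (src C a) m.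
      at ?l a b (h \<cdot> f) k m x = at ?r a b (h \<cdot> f) k m x)"
    by blast
qed

end

theorem theorem4p1:
  fixes C :: "('o, 'm) category"
    and F :: "('o, 'm, 'a) graded_functor"
  assumes "fiber_category C"
    and "contravariant_graded_functor C F"
  shows "bivariant_theory C (coop_group C F) (coop_prod C F) (coop_push C F) (coop_pull C F)"
proof -
  interpret fiber_category C by fact
  interpret contravariant_graded_functor C F by fact
  interpret coop_setting C F ..
  show ?thesis
    by (intro bivariant_theory.intro bivariant_theory_axioms.intro fiber_category_axioms;
      (unfold carrier_coop_group)?;
      (rule comm_group_coop coop_prod_hom_right coop_prod_hom_left coop_push_hom coop_pull_hom
        coop_A1 coop_A2 coop_A3 coop_A12 coop_A13 coop_A23 coop_A123; assumption))
qed

end
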